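(* For every $1<k<3$, the support of the coupling $\pi_k$ constructed in the context is $\Gamma_k$-left-monotone.
   Context: Let $\Gamma_k=\{(x,y)\in\mathbb R^2:y\ge x-k\}$. A set $S\subset\Gamma_k$ is $\Gamma_k$-left-monotone if it contains no three points $(x,y^-),(x,y^+),(x',y')\in S$ such that $x<x'$, $y^-<y'<y^+$ and $y^-\ge x'-k$. Let $\mu$ be uniform on $[-1,1]$ and $b=k-2$. The coupling is $\pi_k(\mathrm dx,\mathrm dy)=\mu(\mathrm dx)[(1-q(x))\delta_{D(x)}(\mathrm dy)+q(x)\delta_{U(x)}(\mathrm dy)]$ with $q(x)=\frac{x-D(x)}{U(x)-D(x)}$ for $x>-1$, $q(-1)=\frac12$, and $D,U:[-1,1]\to[-2,2]$ as follows. Case $1<k<2$. For $0\le\delta\le1$ let $z(\delta)=2-\delta+2k\log\frac{k-1}{k-\delta}$, $y(\delta)=z(\delta)-k$, $A(\delta)=(2-k)\delta-\frac{\delta^2}2+2k[\delta\log(k-1)+(k-\delta)\log(k-\delta)-(k-\delta)]$, $T(\delta)=A(1)-A(\delta)-\big(\frac{(1+\delta)^2}4-1\big)$, $\mathcal W(\delta)=b^2-2b(\delta-1)+2k[(k-\delta)\log\frac{k-\delta}{k-1}+\delta-1]$. $\delta_b\in(0,1)$ is the unique solution of $z(\delta_b)=b$; $\delta_0$ the unique zero of $T$ in $(\delta_b,1)$; $x_0=-\frac{1+\delta_0}2$. Then $D(-1)=U(-1)=-1$; for $-1<x\le x_0$, $D(x)=y(L)$, $U(x)=y(R)$ with $(L,R)$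 the unique solution of $R-L=2(x+1)$, $A(R)-A(L)=x^2-1$, $\delta_b\le L<R\le1$; for $x_0\le x\le b$, parametrically $x=b-\delta+\sqrt{\mathcal W(\delta)}$, $D=z(\delta)-k$, $U=b-\delta+2\sqrt{\mathcal W(\delta)}$, $\delta\in[\delta_b,\delta_0]$; for $b\le x\le1$, $x=z(\delta)$, $D=x-k$, $U=x+\delta$, $\delta\in[\delta_b,1]$. Case $2\le k<3$. Put $a=2k-5$, $E(\eta)=(k-1)\exp\big(\frac{2-\eta}{2k}\big)$, $\rho(\eta)=E(\eta)+\eta-k$, $\eta_b$ the unique solution in $(b,2)$ of $\rho(\eta_b)=b$, $R(\eta)=\sqrt{k^2-(\eta+2)E(\eta)}$. Then $D(x)=-\frac x2-\frac32$, $U(x)=\frac{3x}2+\frac12$ on $[-1,a]$; on $[a,b]$, parametrically $x=E(\eta)-2+R(\eta)$, $D=E(\eta)+\eta-2k$, $U=E(\eta)-2+2R(\eta)$, $\eta\in[\eta_b,2]$; on $[b,1]$, parametrically $x=\rho(\eta)$, $U=\eta$, $D=x-k$, $\eta\in[\eta_b,2]$. In both cases the parametrizations are bijective onto the indicated source intervals and the maps are continuous. *)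

theory Defs
  imports "HOL-Analysis.Analysis"
begin

definition Gam :: "real \<Rightarrow> (real \<times> real) set" where
  "Gam k = {(x, y). y \<ge> x - k}"

definition left_monotone :: "real \<Rightarrow> (real \<times> real) set \<Rightarrow> bool" where
  "left_monotone k S \<longleftrightarrow> S \<subseteq> Gam k \<and>
     \<not> (\<exists>x x' ym yp y'. (x, ym) \<in> S \<and> (x, yp) \<in> S \<and> (x', y') \<in> S \<and>
          x < x' \<and> ym < y' \<and> y' < yp \<and> ym \<ge> x' - k)"

text \<open>On a second-countable space this is the smallest closed set whose complement is null.\<close>

definition measure_support :: "'a::topological_space measure \<Rightarrow> 'a set" where
  "measure_support M = {p. \<forall>V. open V \<and> p \<in> V \<longrightarrow> emeasure M V > 0}"

definition mu :: "real measure" where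
  "mu = uniform_measure lborel {-1..1}"

abbreviation bb :: "real \<Rightarrow> real" where
  "bb k \<equiv> k - 2"


text \<open>
  The maps \<open>lowD\<close> and \<open>upU\<close> below are total on the reals, but only their values on the
  interval from -1 to 1 matter. Where a curve is given parametrically, the parameter is
  recovered by inverting the abscissa on the parameter interval. At a point shared by two
  adjacent pieces, the piece on the left is used.
\<close>

subsection \<open>The case \<open>1 < k < 2\<close>\<close>

definition zf :: "real \<Rightarrow> real \<Rightarrow> real" where
  "zf k \<delta> = 2 - \<delta> + 2 * k * ln ((k - 1) / (k - \<delta>))"

definition yf :: "real \<Rightarrow> real \<Rightarrow> real" where
  "yf k \<delta> = zf k \<delta> - k"

definition Af :: "real \<Rightarrow> real \<Rightarrow> real" where
  "Af k \<delta> = (2 - k) * \<delta> - \<delta>\<^sup>2 / 2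
     + 2 * k * (\<delta> * ln (k - 1) + (k - \<delta>) * ln (k - \<delta>) - (k - \<delta>))"

definition Tf :: "real \<Rightarrow> real \<Rightarrow> real" where
  "Tf k \<delta> = Af k 1 - Af k \<delta> - ((1 + \<delta>)\<^sup>2 / 4 - 1)"

definition Wf :: "real \<Rightarrow> real \<Rightarrow> real" where
  "Wf k \<delta> = (bb k)\<^sup>2 - 2 * bb k * (\<delta> - 1)
     + 2 * k * ((k - \<delta>) * ln ((k - \<delta>) / (k - 1)) + \<delta> - 1)"

definition delta_b :: "real \<Rightarrow> real" where
  "delta_b k = (THE \<delta>. 0 < \<delta> \<and> \<delta> < 1 \<and> zf k \<delta> = bb k)"

definition delta_0 :: "real \<Rightarrow> real" where
  "delta_0 k = (THE \<delta>. delta_b k < \<delta> \<and> \<delta> < 1 \<and> Tf k \<delta> = 0)"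

definition x_0 :: "real \<Rightarrow> real" where
  "x_0 k = - ((1 + delta_0 k) / 2)"

definition LR :: "real \<Rightarrow> real \<Rightarrow> real \<times> real" where
  "LR k x = (THE (L, R). R - L = 2 * (x + 1) \<and> Af k R - Af k L = x\<^sup>2 - 1 \<and>
                         delta_b k \<le> L \<and> L < R \<and> R \<le> 1)"

definition par_mid1 :: "real \<Rightarrow> real \<Rightarrow> real" where
  "par_mid1 k = the_inv_into {delta_b k..delta_0 k} (\<lambda>\<delta>. bb k - \<delta> + sqrt (Wf k \<delta>))"

definition par_right1 :: "real \<Rightarrow> real \<Rightarrow> real" where
  "par_right1 k = the_inv_into {delta_b k..1} (zf k)"

definition D1 :: "real \<Rightarrow> real \<Rightarrow> real" where
  "D1 k x =
     (if x \<le> -1 then -1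
      else if x \<le> x_0 k then yf k (fst (LR k x))
      else if x \<le> bb k then zf k (par_mid1 k x) - k
      else x - k)"

definition U1 :: "real \<Rightarrow> real \<Rightarrow> real" where
  "U1 k x =
     (if x \<le> -1 then -1
      else if x \<le> x_0 k then yf k (snd (LR k x))
      else if x \<le> bb k then bb k - par_mid1 k x + 2 * sqrt (Wf k (par_mid1 k x))
      else x + par_right1 k x)"


subsection \<open>The case \<open>2 \<le> k < 3\<close>\<close>

abbreviation aa :: "real \<Rightarrow> real" where
  "aa k \<equiv> 2 * k - 5"

definition Ef :: "real \<Rightarrow> real \<Rightarrow> real" where
  "Ef k \<eta> = (k - 1) * exp ((2 - \<eta>) / (2 * k))"

definition rho :: "real \<Rightarrow> real \<Rightarrow> real" where
  "rho k \<eta> = Ef k \<eta> + \<eta> - k"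

definition eta_b :: "real \<Rightarrow> real" where
  "eta_b k = (THE \<eta>. bb k < \<eta> \<and> \<eta> < 2 \<and> rho k \<eta> = bb k)"

definition Rf :: "real \<Rightarrow> real \<Rightarrow> real" where
  "Rf k \<eta> = sqrt (k\<^sup>2 - (\<eta> + 2) * Ef k \<eta>)"

definition par_mid2 :: "real \<Rightarrow> real \<Rightarrow> real" where
  "par_mid2 k = the_inv_into {eta_b k..2} (\<lambda>\<eta>. Ef k \<eta> - 2 + Rf k \<eta>)"

definition par_right2 :: "real \<Rightarrow> real \<Rightarrow> real" where
  "par_right2 k = the_inv_into {eta_b k..2} (rho k)"

definition D2 :: "real \<Rightarrow> real \<Rightarrow> real" where
  "D2 k x =
     (if x \<le> aa k then - x / 2 - 3 / 2
      else if x \<le> bb k then Ef k (par_mid2 k x) + par_mid2 k x - 2 * k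
      else x - k)"

definition U2 :: "real \<Rightarrow> real \<Rightarrow> real" where
  "U2 k x =
     (if x \<le> aa k then 3 * x / 2 + 1 / 2
      else if x \<le> bb k then Ef k (par_mid2 k x) - 2 + 2 * Rf k (par_mid2 k x)
      else par_right2 k x)"


subsection \<open>The coupling\<close>

definition lowD :: "real \<Rightarrow> real \<Rightarrow> real" where
  "lowD k x = (if k < 2 then D1 k x else D2 k x)"

definition upU :: "real \<Rightarrow> real \<Rightarrow> real" where
  "upU k x = (if k < 2 then U1 k x else U2 k x)"

definition qf :: "real \<Rightarrow> real \<Rightarrow> real" where
  "qf k x = (if x > -1 then (x - lowD k x) / (upU k x - lowD k x) else 1 / 2)"

definition coupling :: "real \<Rightarrow> (real \<times> real) measure" where
  "coupling k = measure_of UNIV (sets borel)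
     (\<lambda>B. \<integral>\<^sup>+ x. ennreal (1 - qf k x) * indicator B (x, lowD k x)
                + ennreal (qf k x) * indicator B (x, upU k x) \<partial>mu)"

end

theory Submission
  imports Defs
begin

text \<open>
  It suffices that \<open>D\<close> and \<open>U\<close> are continuous, \<open>D\<close> is nonincreasing on \<open>[-1, b]\<close>, \<open>U\<close> is
  nondecreasing on \<open>[-1, 1]\<close>, and \<open>D(x) = x - k\<close> on \<open>[b, 1]\<close>. By continuity the support lies in the
  union of the two graphs. For \<open>x < x' \<le> b\<close> the interval between \<open>D(x')\<close> and \<open>U(x')\<close> contains the
  one between \<open>D(x)\<close> and \<open>U(x)\<close>; for \<open>x' > b\<close>, the visibility condition \<open>D(x) \<ge> x' - k = D(x')\<close>
  gives the same inclusion.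

  Where the curves are parametric, monotonicity is a sign computation; for \<open>k < 2\<close> it rests on the
  identity \<open>W(\<delta>) = ((\<delta> - 1) / 2 - b)\<^sup>2 - T(\<delta>)\<close> and on \<open>T \<le> 0\<close> and \<open>T' > 0\<close> left of \<open>\<delta>\<^sub>0\<close>.
  For the pair \<open>(L, R)\<close>, the function \<open>A(R) - A(L) - (R - L)\<^sup>2 / 4 + (R - L)\<close> vanishes on the diagonal,
  is convex in \<open>R\<close>, concave in \<open>L\<close>, and increasing under translations; so if \<open>R - L\<close> grows along
  its zeros, then \<open>L\<close> decreases and \<open>R\<close> increases, both at most as fast as \<open>R - L\<close>, hence
  continuously.
\<close>

section \<open>Graphs, inverse functions and convexity\<close>

lemma measure_support_coupling_subset:
  assumes "closed S"
    and S: "\<And>x. -1 \<le> x \<Longrightarrow> x \<le> 1 \<Longrightarrow> (x, lowD k x) \<in> S \<and> (x, upU k x) \<in> S"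
  shows "measure_support (coupling k) \<subseteq> S"
proof
  fix p assume p: "p \<in> measure_support (coupling k)"
  show "p \<in> S"
  proof (rule ccontr)
    assume "p \<notin> S"
    have "AE x in mu. x \<in> {-1..1}"
      unfolding mu_def by (rule AE_uniform_measureI) auto
    then have "AE x in mu. ennreal (1 - qf k x) * indicator (- S) (x, lowD k x)
                + ennreal (qf k x) * indicator (- S) (x, upU k x) = 0"
      by eventually_elim (use S in auto)
    then have "(\<integral>\<^sup>+ x. ennreal (1 - qf k x) * indicator (- S) (x, lowD k x)
                + ennreal (qf k x) * indicator (- S) (x, upU k x) \<partial>mu) = (\<integral>\<^sup>+ x. 0 \<partial>mu)"
      by (rule nn_integral_cong_AE)
    \<comment> \<open>The measure built by \<open>measure_of\<close> takes either the value of this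
      integral or, by default, 0; the conclusion holds in both cases.\<close>
    then have "emeasure (coupling k) (- S) = 0"
      unfolding coupling_def emeasure_measure_of_conv by simp
    moreover have "open (- S)"
      using \<open>closed S\<close> by auto
    ultimately show False
      using p \<open>p \<notin> S\<close> by (force simp: measure_support_def)
  qed
qed

lemma left_monotone_subset: "left_monotone k S" if "left_monotone k T" "S \<subseteq> T"
  using that unfolding left_monotone_def by (meson subset_iff subset_trans)

lemma left_monotone_coupling:
  fixes k :: real
  assumes b: "-1 \<le> bb k" "bb k \<le> 1"
    and cD: "continuous_on {-1..1} (lowD k)" and cU: "continuous_on {-1..1} (upU k)"
    and D: "antimono_on {-1..bb k} (lowD k)" and U: "mono_on {-1..1} (upU k)"
    and start: "lowD k (-1) \<le> upU k (-1)"
    and diag: "\<And>x. bb k \<le> x \<Longrightarrow> x \<le> 1 \<Longrightarrow> lowD k x = x - k \<and> x - k \<le> upU k x"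
  shows "left_monotone k (measure_support (coupling k))"
proof -
  define S where "S = (\<lambda>x. (x, lowD k x)) ` {-1..1} \<union> (\<lambda>x. (x, upU k x)) ` {-1..1}"
  have "closed S"
    unfolding S_def
    by (intro closed_Un compact_imp_closed compact_continuous_image continuous_intros cD cU) auto
  then have sub: "measure_support (coupling k) \<subseteq> S"
    by (rule measure_support_coupling_subset) (auto simp: S_def)
  have D_le: "lowD k x' \<le> lowD k x" if "-1 \<le> x" "x \<le> x'" "x' \<le> bb k" for x x'
    using D that by (auto simp: monotone_on_def)
  have U_le: "upU k x \<le> upU k x'" if "-1 \<le> x" "x \<le> x'" "x' \<le> 1" for x x'
    using U that by (auto simp: monotone_on_def)
  have DU: "lowD k x \<le> upU k x" if x: "-1 \<le> x" "x \<le> 1" for x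
  proof (cases "x \<le> bb k")
    case True
    then show ?thesis using D_le[of "-1" x] U_le[of "-1" x] start x by auto
  next
    case False
    then show ?thesis using diag[of x] x by auto
  qed
  have D_ge: "x - k \<le> lowD k x" if x: "-1 \<le> x" "x \<le> 1" for x
  proof (cases "x \<le> bb k")
    case True
    \<comment> \<open>Left of \<open>b\<close> one has
      \<open>D(x) \<ge> D(b) = b - k \<ge> x - k\<close>.\<close>
    then show ?thesis using D_le[of x "bb k"] diag[of "bb k"] b x by auto
  next
    case False
    then show ?thesis using diag[of x] x by auto
  qed
  have nested: "\<not> (lowD k x < y' \<and> y' < upU k x)"
    if x: "-1 \<le> x" "x < x'" "x' \<le> 1" and vis: "x' - k \<le> lowD k x"
      and y': "y' = lowD k x' \<or> y' = upU k x'" for x x' y'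
  proof (cases "x' \<le> bb k")
    case True
    then show ?thesis using D_le[of x x'] U_le[of x x'] x y' by auto
  next
    case False
    then show ?thesis using diag[of x'] U_le[of x x'] x y' vis by auto
  qed
  have "left_monotone k S"
    unfolding left_monotone_def
  proof (intro conjI notI)
    show "S \<subseteq> Gam k"
      using D_ge DU by (force simp: S_def Gam_def)
  next
    assume "\<exists>x x' ym yp y'. (x, ym) \<in> S \<and> (x, yp) \<in> S \<and> (x', y') \<in> S \<and>
          x < x' \<and> ym < y' \<and> y' < yp \<and> ym \<ge> x' - k"
    then obtain x x' ym yp y' where *: "(x, ym) \<in> S" "(x, yp) \<in> S" "(x', y') \<in> S"
      "x < x'" "ym < y'" "y' < yp" "ym \<ge> x' - k"
      by blast
    from * have "-1 \<le> x" "x' \<le> 1" "y' = lowD k x' \<or> y' = upU k x'"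
      and "ym = lowD k x \<or> ym = upU k x" "yp = lowD k x \<or> yp = upU k x"
      by (auto simp: S_def)
    \<comment> \<open>Since \<open>D(x) \<le> U(x)\<close> and \<open>ym < yp\<close>, the two
      points over \<open>x\<close> can only be \<open>ym = D(x)\<close> and
      \<open>yp = U(x)\<close>.\<close>
    with * nested[of x x' y'] DU[of x] show False
      by auto
  qed
  then show ?thesis
    using sub by (rule left_monotone_subset)
qed

section \<open>Gluing pieces, inverting parametrizations, and slopes of convex functions\<close>

text \<open>The relation \<open>R\<close> on the values is kept general so that the same fact serves
  increasing and decreasing functions.\<close>

lemma monotone_on_glue:
  fixes a b c :: real
  assumes f: "monotone_on {a..b} (\<le>) R f" "monotone_on {b..c} (\<le>) R f"
    and R: "transp R" and "a \<le> b" "b \<le> c"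
  shows "monotone_on {a..c} (\<le>) R f"
proof (rule monotone_onI)
  fix x y assume xy: "x \<in> {a..c}" "y \<in> {a..c}" "x \<le> y"
  consider "y \<le> b" | "b \<le> x" | "x \<le> b" "b \<le> y" by linarith
  then show "R (f x) (f y)"
  proof cases
    case 3
    then have "R (f x) (f b)" "R (f b) (f y)"
      using f xy by (auto simp: monotone_on_def)
    then show ?thesis using R by (rule transpD[rotated])
  qed (use f xy in \<open>auto simp: monotone_on_def\<close>)
qed

lemma continuous_on_glue:
  fixes a b c :: real
  assumes "continuous_on {a..b} f" "continuous_on {b..c} f" "a \<le> b" "b \<le> c"
  shows "continuous_on {a..c} f"
proof -
  have "{a..c} = {a..b} \<union> {b..c}" using assms by auto
  then show ?thesis using assms by (simp add: continuous_on_closed_Un)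
qed

lemma continuous_on_the_inv_into:
  fixes f :: "real \<Rightarrow> real"
  assumes "continuous_on {p..q} f" "inj_on f {p..q}"
  shows "continuous_on (f ` {p..q}) (the_inv_into {p..q} f)"
  using assms by (intro continuous_on_inv) (auto simp: the_inv_into_f_f)

lemma image_strict_mono_Icc:
  fixes f :: "real \<Rightarrow> real"
  assumes cont: "continuous_on {p..q} f" and f: "strict_mono_on {p..q} f" and "p \<le> q"
  shows "f ` {p..q} = {f p..f q}"
proof
  have le: "f s \<le> f t" if "p \<le> s" "s \<le> t" "t \<le> q" for s t
    using strict_mono_on_leD[OF f] that by auto
  then show "f ` {p..q} \<subseteq> {f p..f q}" using \<open>p \<le> q\<close> by auto
  show "{f p..f q} \<subseteq> f ` {p..q}"
  proof
    fix x assume "x \<in> {f p..f q}"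
    then obtain t where "p \<le> t" "t \<le> q" "f t = x"
      using IVT'[of f p x q] cont \<open>p \<le> q\<close> by auto
    then show "x \<in> f ` {p..q}" by auto
  qed
qed

text \<open>Collects what a parametric piece needs from its recovered parameter: range, continuity,
  monotonicity and end values. Continuity comes from compactness of the parameter interval.\<close>

lemma the_inv_into_strict_mono:
  fixes f :: "real \<Rightarrow> real"
  assumes cont: "continuous_on {p..q} f" and f: "strict_mono_on {p..q} f" and "p \<le> q"
  defines "g \<equiv> the_inv_into {p..q} f"
  shows "g ` {f p..f q} = {p..q}" "continuous_on {f p..f q} g" "mono_on {f p..f q} g"
    "g (f p) = p" "g (f q) = q"
proof -
  note im = image_strict_mono_Icc[OF cont f \<open>p \<le> q\<close>]
  have inj: "inj_on f {p..q}" using f by (rule strict_mono_on_imp_inj_on)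
  show "g ` {f p..f q} = {p..q}"
    unfolding g_def im[symmetric] using the_inv_into_onto[OF inj] .
  show "continuous_on {f p..f q} g"
    unfolding g_def im[symmetric] using continuous_on_the_inv_into[OF cont inj] .
  have gf: "g (f t) = t" if "t \<in> {p..q}" for t
    unfolding g_def using the_inv_into_f_f[OF inj that] .
  show "g (f p) = p" "g (f q) = q" using gf \<open>p \<le> q\<close> by auto
  show "mono_on {f p..f q} g"
    unfolding im[symmetric]
    by (rule monotone_onI) (use f gf in \<open>auto simp: strict_mono_on_less_eq\<close>)
qed

lemma the_inv_into_strict_antimono:
  fixes f :: "real \<Rightarrow> real"
  assumes cont: "continuous_on {p..q} f" and f: "strict_antimono_on {p..q} f" and "p \<le> q"
  defines "g \<equiv> the_inv_into {p..q} f"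
  shows "g ` {f q..f p} = {p..q}" "continuous_on {f q..f p} g" "antimono_on {f q..f p} g"
    "g (f p) = p" "g (f q) = q"
proof -
  \<comment> \<open>Negation reduces the computation of the image to the increasing case.\<close>
  have m: "strict_mono_on {p..q} (\<lambda>t. - f t)" using f by (auto simp: monotone_on_def)
  have "(\<lambda>t. - f t) ` {p..q} = {- f p..- f q}"
    by (intro image_strict_mono_Icc m \<open>p \<le> q\<close> continuous_intros cont)
  then have "uminus ` (\<lambda>t. - f t) ` {p..q} = {f q..f p}" by simp
  then have im: "f ` {p..q} = {f q..f p}" by (simp add: image_image)
  have inj: "inj_on f {p..q}"
    using strict_mono_on_imp_inj_on[OF m] by (auto simp: inj_on_def)
  show "g ` {f q..f p} = {p..q}"
    unfolding g_def im[symmetric] using the_inv_into_onto[OF inj] .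
  show "continuous_on {f q..f p} g"
    unfolding g_def im[symmetric] using continuous_on_the_inv_into[OF cont inj] .
  have gf: "g (f t) = t" if "t \<in> {p..q}" for t
    unfolding g_def using the_inv_into_f_f[OF inj that] .
  show "g (f p) = p" "g (f q) = q" using gf \<open>p \<le> q\<close> by auto
  show "antimono_on {f q..f p} g"
    unfolding im[symmetric]
  proof (rule monotone_onI)
    fix x y assume "x \<in> f ` {p..q}" "y \<in> f ` {p..q}" "x \<le> y"
    then obtain s t where "s \<in> {p..q}" "t \<in> {p..q}" "x = f s" "y = f t" by auto
    then show "g y \<le> g x"
      using monotone_onD[OF f, of s t] gf \<open>x \<le> y\<close> by fastforce
  qed
qed

lemma strict_mono_on_deriv_pos:
  fixes f :: "real \<Rightarrow> real"
  assumes "\<And>t. p \<le> t \<Longrightarrow> t \<le> q \<Longrightarrow> (f has_real_derivative f' t) (at t) \<and> f' t > 0"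
  shows "strict_mono_on {p..q} f"
  by (rule strict_mono_onI, rule DERIV_pos_imp_increasing[where f = f])
    (use assms in \<open>auto, meson order_trans\<close>)

text \<open>By the mean value theorem the two chord slopes are values of \<open>f'\<close> at points
  on either side of \<open>q\<close>.\<close>

lemma strictly_convex_slopes:
  fixes f :: "real \<Rightarrow> real"
  assumes "p < q" "q < r"
    and der: "\<And>t. p \<le> t \<Longrightarrow> t \<le> r \<Longrightarrow> (f has_real_derivative f' t) (at t)"
    and mono: "strict_mono_on {p..r} f'"
  shows "(f q - f p) / (q - p) < (f r - f q) / (r - q)"
proof -
  obtain s where s: "p < s" "s < q" "f q - f p = (q - p) * f' s"
    using MVT2[of p q f f'] der assms by force
  obtain t where t: "q < t" "t < r" "f r - f q = (r - q) * f' t"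
    using MVT2[of q r f f'] der assms by force
  have "f' s < f' t"
    using strict_mono_onD[OF mono, of s t] s t by auto
  then show ?thesis using s t assms by simp
qed

lemma continuous_on_lipschitz_Icc:
  fixes f :: "real \<Rightarrow> real"
  assumes "0 \<le> C" and f: "\<And>x y. a \<le> x \<Longrightarrow> x \<le> y \<Longrightarrow> y \<le> b \<Longrightarrow> \<bar>f x - f y\<bar> \<le> C * (y - x)"
  shows "continuous_on {a..b} f"
proof (rule lipschitz_on_continuous_on, rule lipschitz_onI)
  fix x y assume "x \<in> {a..b}" "y \<in> {a..b}"
  then show "dist (f x) (f y) \<le> C * dist x y"
    using f[of x y] f[of y x] by (cases "x \<le> y") (auto simp: dist_real_def abs_minus_commute)
qed fact

text \<open>The bound \<open>ln u \<le> u - 1\<close> is used at \<open>u = 2 * (k - 1) / k\<close>;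
  the factor 2 moves the point of tangency to \<open>k = 2\<close>, and
  \<open>ln 2 \<ge> 2 / 3 > 1 / 2\<close> supplies the strictness. This is \<open>z(0) < b\<close>
  in the first case and \<open>E(b) < k\<close> in the second.\<close>

lemma ln_ratio_less:
  fixes k :: real
  assumes "1 < k"
  shows "2 * k * ln ((k - 1) / k) < k - 4"
proof -
  have "ln (2 * ((k - 1) / k)) \<le> 2 * ((k - 1) / k) - 1"
    by (rule ln_le_minus_one) (use assms in auto)
  moreover have "ln (2 * ((k - 1) / k)) = ln 2 + ln ((k - 1) / k)"
    using assms by (intro ln_mult_pos) auto
  ultimately have "ln ((k - 1) / k) < 2 * ((k - 1) / k) - 3 / 2"
    using ln2_ge_two_thirds by linarith
  then have "2 * k * ln ((k - 1) / k) < 2 * k * (2 * ((k - 1) / k) - 3 / 2)"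
    using assms by (intro mult_strict_left_mono) auto
  also have "\<dots> = k - 4" using assms by (simp add: field_simps)
  finally show ?thesis .
qed

section \<open>The case \<open>1 < k < 2\<close>\<close>

lemma DERIV_zf:
  assumes "1 < k" "\<delta> < k"
  shows "(zf k has_real_derivative (k + \<delta>) / (k - \<delta>)) (at \<delta>)"
proof -
  have "((\<lambda>\<delta>. ln ((k - 1) / (k - \<delta>))) has_real_derivative 1 / (k - \<delta>)) (at \<delta>)"
    using assms by (auto intro!: derivative_eq_intros simp: divide_simps)
  from DERIV_cmult[OF this, of "2 * k"] show ?thesis
    unfolding zf_def using assms
    by (auto intro!: derivative_eq_intros simp: divide_simps)
qed

lemma DERIV_Af:
  assumes "1 < k" "\<delta> < k"
  shows "(Af k has_real_derivative yf k \<delta>) (at \<delta>)"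
  unfolding Af_def yf_def zf_def using assms
  by (auto intro!: derivative_eq_intros simp: ln_div power2_eq_square)

text \<open>Eliminates \<open>x\<close> from the equations for \<open>(L, R)\<close>: if
  \<open>R - L = 2 * (x + 1)\<close>, then \<open>x^2 - 1 = (R - L)^2 / 4 - (R - L)\<close>, so the
  second equation says that \<open>gap\<close> vanishes.\<close>

definition gap :: "real \<Rightarrow> real \<Rightarrow> real \<Rightarrow> real" where
  "gap k L R = Af k R - Af k L - (R - L)\<^sup>2 / 4 + (R - L)"

context
  fixes k :: real
  assumes k: "1 < k" "k < 2"
begin

text \<open>The derivative \<open>(k + \<delta>) / (k - \<delta>)\<close> is at least 1 for
  \<open>\<delta> \<ge> 0\<close>. This slope is what makes \<open>gap\<close> convex in
  \<open>R\<close> and concave in \<open>L\<close>, and \<open>T'\<close> decreasing.\<close>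

lemma zf_diff_ge: "t - s \<le> zf k t - zf k s" if "0 \<le> s" "s \<le> t" "t \<le> 1"
proof -
  have "zf k s - s \<le> zf k t - t"
  proof (rule DERIV_nonneg_imp_nondecreasing[OF \<open>s \<le> t\<close>])
    fix x assume x: "s \<le> x" "x \<le> t"
    then have "((\<lambda>t. zf k t - t) has_real_derivative (k + x) / (k - x) - 1) (at x)"
      using that k by (intro DERIV_diff DERIV_zf DERIV_ident) auto
    moreover have "1 \<le> (k + x) / (k - x)" using that k x by simp
    ultimately show "\<exists>y. ((\<lambda>t. zf k t - t) has_real_derivative y) (at x) \<and> 0 \<le> y"
      by force
  qed
  then show ?thesis by simp
qed

lemma zf_diff_le: "zf k t - zf k s \<le> (k + 1) / (k - 1) * (t - s)" if "0 \<le> s" "s \<le> t" "t \<le> 1"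
proof -
  define C where "C = (k + 1) / (k - 1)"
  have "C * s - zf k s \<le> C * t - zf k t"
  proof (rule DERIV_nonneg_imp_nondecreasing[OF \<open>s \<le> t\<close>])
    fix x assume x: "s \<le> x" "x \<le> t"
    then have "((\<lambda>t. C * t - zf k t) has_real_derivative C - (k + x) / (k - x)) (at x)"
      using that k by (intro DERIV_diff DERIV_zf DERIV_cmult_Id) auto
    moreover have "(k + x) / (k - x) \<le> C"
      unfolding C_def using that k x by (intro frac_le) auto
    ultimately show "\<exists>y. ((\<lambda>t. C * t - zf k t) has_real_derivative y) (at x) \<and> 0 \<le> y"
      by force
  qed
  then show ?thesis unfolding C_def[symmetric] by (simp add: right_diff_distrib)
qed

lemma strict_mono_zf: "strict_mono_on {0..1} (zf k)"
proof (rule strict_mono_onI)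
  fix r s :: real assume "r \<in> {0..1}" "s \<in> {0..1}" "r < s"
  then show "zf k r < zf k s" using zf_diff_ge[of r s] by auto
qed

lemma continuous_zf: "continuous_on {0..1} (zf k)"
  by (rule DERIV_continuous_on, rule has_field_derivative_at_within, rule DERIV_zf) (use k in auto)

lemma yf_less_iff: "0 \<le> s \<Longrightarrow> s \<le> 1 \<Longrightarrow> 0 \<le> t \<Longrightarrow> t \<le> 1 \<Longrightarrow> yf k s < yf k t \<longleftrightarrow> s < t"
  using strict_mono_on_less[OF strict_mono_zf, of s t] by (simp add: yf_def)

lemma zf_1: "zf k 1 = 1" and yf_1: "yf k 1 = 1 - k"
  using k by (auto simp: zf_def yf_def)

lemma zf_0_less: "zf k 0 < bb k"
  using ln_ratio_less[OF k(1)] by (simp add: zf_def)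

section \<open>Location of \<open>delta_b\<close> and \<open>delta_0\<close>\<close>

lemma delta_b: "0 < delta_b k" "delta_b k < 1" "zf k (delta_b k) = bb k"
proof -
  obtain d where d: "0 \<le> d" "d \<le> 1" "zf k d = bb k"
    using IVT'[of "zf k" 0 "bb k" 1] zf_0_less zf_1 k continuous_zf by auto
  have "d \<noteq> 0" "d \<noteq> 1" using d zf_0_less zf_1 k by auto
  then have "\<exists>!\<delta>. 0 < \<delta> \<and> \<delta> < 1 \<and> zf k \<delta> = bb k"
    using d strict_mono_on_eqD[OF strict_mono_zf]
    by (intro ex1I[of _ d]) auto
  from theI'[OF this]
  show "0 < delta_b k" "delta_b k < 1" "zf k (delta_b k) = bb k"
    by (auto simp: delta_b_def)
qed

text \<open>Bounds \<open>delta_b\<close> from below by evaluating \<open>z\<close> at a test point,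
  which may be negative.\<close>

lemma delta_b_greaterI: "t < delta_b k" if "zf k t < bb k" "t \<le> 1"
proof (rule ccontr)
  assume "\<not> t < delta_b k"
  then have "zf k (delta_b k) \<le> zf k t"
    using zf_diff_ge[of "delta_b k" t] delta_b that by auto
  then show False using that delta_b by auto
qed

lemma yf_delta_b: "yf k (delta_b k) = -2"
  using delta_b by (simp add: yf_def)

lemma Wf_eq: "Wf k \<delta> = ((\<delta> - 1) / 2 - bb k)\<^sup>2 - Tf k \<delta>" if "\<delta> < k"
  using that k
  by (simp add: Wf_def Tf_def Af_def ln_div power2_eq_square field_simps)

text \<open>The equation \<open>z(\<delta>) = b\<close> eliminates the logarithm from
  \<open>W\<close>.\<close>

lemma Wf_delta_b: "Wf k (delta_b k) = (delta_b k)\<^sup>2"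
proof -
  let ?d = "delta_b k"
  have "2 * k * ln ((k - ?d) / (k - 1)) = 4 - k - ?d"
    using delta_b k by (simp add: zf_def ln_div algebra_simps)
  then have "2 * k * ((k - ?d) * ln ((k - ?d) / (k - 1)) + ?d - 1)
      = (k - ?d) * (4 - k - ?d) + 2 * k * (?d - 1)"
    by algebra
  then show ?thesis
    unfolding Wf_def by (simp add: power2_eq_square algebra_simps)
qed

text \<open>Together the two bounds say that
  \<open>\<bar>(\<delta> - 1) / 2 - b\<bar> < \<delta>\<close> at
  \<open>\<delta> = delta_b k\<close>, which gives the sign of \<open>T\<close> there.\<close>

lemma delta_b_greater: "3 - 2 * k < delta_b k" "(2 * k - 3) / 3 < delta_b k"
proof -
  have "1 \<le> ln (3::real)"
    using exp_le by (simp add: ln_ge_iff)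
  moreover have "zf k (3 - 2 * k) = 2 * k - 1 - 2 * k * ln 3"
  proof -
    have *: "(k - 1) / (k - (3 - 2 * k)) = 1 / 3" using k by (simp add: field_simps)
    show ?thesis unfolding zf_def * by (simp add: ln_div)
  qed
  moreover have "2 * k * 1 \<le> 2 * k * ln 3"
    using k calculation by (intro mult_left_mono) auto
  ultimately have "zf k (3 - 2 * k) < bb k" using k by linarith
  then show "3 - 2 * k < delta_b k" using k by (intro delta_b_greaterI) auto
next
  \<comment> \<open>The argument of the logarithm in \<open>z\<close> at the test point
    \<open>(2 * k - 3) / 3\<close>.\<close>
  define u where "u = 3 * (k - 1) / (k + 3)"
  have "u > 0" using k by (simp add: u_def)
  have "ln (2 * u) \<le> 2 * u - 1"
    using \<open>u > 0\<close> by (intro ln_le_minus_one) auto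
  then have "ln u \<le> 2 * u - 5 / 3"
    using \<open>u > 0\<close> ln2_ge_two_thirds by (simp add: ln_mult)
  then have "2 * k * ln u \<le> 2 * k * (2 * u - 5 / 3)"
    using k by (intro mult_left_mono) auto
  moreover have "2 * k * (2 * u - 5 / 3) < 5 * k / 3 - 5"
  proof -
    \<comment> \<open>Clearing the denominator \<open>3 * (k + 3)\<close> turns the claim into three
      times this inequality.\<close>
    have "(7 * k - 15) * (k - 1) < 0" using k by (intro mult_neg_pos) auto
    then show ?thesis using k by (simp add: u_def field_simps)
  qed
  moreover have "zf k ((2 * k - 3) / 3) = 3 - 2 * k / 3 + 2 * k * ln u"
  proof -
    have "(k - 1) / (k - (2 * k - 3) / 3) = u" using k by (simp add: u_def field_simps)
    then show ?thesis unfolding zf_def by (simp add: field_simps)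
  qed
  ultimately have "zf k ((2 * k - 3) / 3) < bb k" by linarith
  then show "(2 * k - 3) / 3 < delta_b k" using k by (intro delta_b_greaterI) auto
qed

lemma Tf_delta_b: "Tf k (delta_b k) < 0"
proof -
  let ?d = "delta_b k"
  have "(?d - 1) / 2 - bb k < ?d" "- ((?d - 1) / 2 - bb k) < ?d"
    using delta_b_greater by (simp_all add: field_simps)
  then have "\<bar>(?d - 1) / 2 - bb k\<bar> < \<bar>?d\<bar>" using delta_b(1) by linarith
  then have "((?d - 1) / 2 - bb k)\<^sup>2 < ?d\<^sup>2" by (simp add: abs_le_square_iff flip: linorder_not_le)
  then show ?thesis using Wf_eq[of ?d] Wf_delta_b delta_b k by auto
qed

lemma DERIV_Tf:
  assumes "\<delta> < k"
  shows "(Tf k has_real_derivative - yf k \<delta> - (1 + \<delta>) / 2) (at \<delta>)"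
  unfolding Tf_def using assms k
  by (auto intro!: derivative_eq_intros DERIV_Af simp: field_simps)

lemma Tf_1: "Tf k 1 = 0"
  by (simp add: Tf_def)

text \<open>\<open>T'\<close> is strictly decreasing, positive at \<open>delta_b k\<close> and
  negative at 1. Hence \<open>T\<close> climbs from a negative value up to the zero \<open>c\<close>
  of \<open>T'\<close> and then falls to \<open>T(1) = 0\<close>, so it is positive on
  \<open>[c, 1)\<close> and crosses zero once before \<open>c\<close>. The last property says that
  \<open>T' > 0\<close> left of \<open>c\<close>.\<close>

lemma delta_0_aux:
  obtains c d where "delta_b k < d" "d < c" "c < 1" "Tf k d = 0"
    "strict_mono_on {delta_b k..c} (Tf k)" "\<And>\<delta>. c \<le> \<delta> \<Longrightarrow> \<delta> < 1 \<Longrightarrow> 0 < Tf k \<delta>"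
    "\<And>\<delta>. delta_b k \<le> \<delta> \<Longrightarrow> \<delta> < c \<Longrightarrow> yf k \<delta> < - (1 + \<delta>) / 2"
proof -
  define T' where "T' = (\<lambda>\<delta>. - yf k \<delta> - (1 + \<delta>) / 2)"
  have der: "(Tf k has_real_derivative T' \<delta>) (at \<delta>)" if "\<delta> \<le> 1" for \<delta>
    using DERIV_Tf[of \<delta>] that k by (simp add: T'_def)
  have T'_less: "T' t < T' s" if "delta_b k \<le> s" "s < t" "t \<le> 1" for s t
    using zf_diff_ge[of s t] delta_b(1) that by (simp add: T'_def yf_def field_simps)
  have "continuous_on {delta_b k..1} (\<lambda>\<delta>. - T' \<delta>)"
    unfolding T'_def yf_def
    by (intro continuous_intros continuous_on_subset[OF continuous_zf]) (use delta_b in auto)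
  moreover have "T' 1 < 0" "0 < T' (delta_b k)"
    using k delta_b by (auto simp: T'_def yf_1 yf_delta_b)
  ultimately obtain c where c: "delta_b k \<le> c" "c \<le> 1" "T' c = 0"
    using IVT'[of "\<lambda>\<delta>. - T' \<delta>" "delta_b k" 0 1] delta_b by auto
  have "c \<noteq> 1" "c \<noteq> delta_b k" using c \<open>T' 1 < 0\<close> \<open>0 < T' (delta_b k)\<close> by auto
  have incr: "strict_mono_on {delta_b k..c} (Tf k)"
  proof (rule strict_mono_onI)
    fix s t assume st: "s \<in> {delta_b k..c}" "t \<in> {delta_b k..c}" "s < t"
    show "Tf k s < Tf k t"
    proof (rule DERIV_pos_imp_increasing_open[OF \<open>s < t\<close>])
      fix x assume "s < x" "x < t"
      then show "\<exists>y. (Tf k has_real_derivative y) (at x) \<and> 0 < y"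
        using der[of x] T'_less[of x c] c st by auto
    next
      show "continuous_on {s..t} (Tf k)"
        by (rule DERIV_continuous_on, rule has_field_derivative_at_within, rule der) (use st c in auto)
    qed
  qed
  have pos: "0 < Tf k \<delta>" if "c \<le> \<delta>" "\<delta> < 1" for \<delta>
  proof -
    have "Tf k 1 < Tf k \<delta>"
    proof (rule DERIV_neg_imp_decreasing_open[OF \<open>\<delta> < 1\<close>])
      fix x assume "\<delta> < x" "x < 1"
      then show "\<exists>y. (Tf k has_real_derivative y) (at x) \<and> y < 0"
        using der[of x] T'_less[of c x] c that by auto
    next
      show "continuous_on {\<delta>..1} (Tf k)"
        by (rule DERIV_continuous_on, rule has_field_derivative_at_within, rule der) auto
    qed
    then show ?thesis by (simp add: Tf_1)
  qed
  have "continuous_on {delta_b k..c} (Tf k)"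
    by (rule DERIV_continuous_on, rule has_field_derivative_at_within, rule der) (use c in auto)
  then obtain d where d: "delta_b k \<le> d" "d \<le> c" "Tf k d = 0"
    using IVT'[of "Tf k" "delta_b k" 0 c] Tf_delta_b pos[of c] c \<open>c \<noteq> 1\<close> by auto
  show ?thesis
  proof (rule that[of d c])
    show "delta_b k < d" "d < c"
      using d Tf_delta_b pos[of c] c \<open>c \<noteq> 1\<close> by (auto simp: less_le)
    show "yf k \<delta> < - (1 + \<delta>) / 2" if "delta_b k \<le> \<delta>" "\<delta> < c" for \<delta>
      using T'_less[of \<delta> c] c that by (simp add: T'_def field_simps)
  qed (use c d incr pos \<open>c \<noteq> 1\<close> in auto)
qed

lemma delta_0: "delta_b k < delta_0 k" "delta_0 k < 1" "Tf k (delta_0 k) = 0"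
  and Tf_neg: "delta_b k \<le> \<delta> \<Longrightarrow> \<delta> < delta_0 k \<Longrightarrow> Tf k \<delta> < 0"
  and Tf_pos: "delta_0 k < \<delta> \<Longrightarrow> \<delta> < 1 \<Longrightarrow> 0 < Tf k \<delta>"
  and yf_less_delta_0: "delta_b k \<le> \<delta> \<Longrightarrow> \<delta> \<le> delta_0 k \<Longrightarrow> yf k \<delta> < - (1 + \<delta>) / 2"
proof -
  obtain c d where d: "delta_b k < d" "d < c" "c < 1" "Tf k d = 0"
    and incr: "strict_mono_on {delta_b k..c} (Tf k)"
    and pos: "\<And>\<delta>. c \<le> \<delta> \<Longrightarrow> \<delta> < 1 \<Longrightarrow> 0 < Tf k \<delta>"
    and y: "\<And>\<delta>. delta_b k \<le> \<delta> \<Longrightarrow> \<delta> < c \<Longrightarrow> yf k \<delta> < - (1 + \<delta>) / 2"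
    using delta_0_aux by metis
  have neg: "Tf k \<delta> < 0" if "delta_b k \<le> \<delta>" "\<delta> < d" for \<delta>
    using strict_mono_onD[OF incr, of \<delta> d] d that by auto
  have pos': "0 < Tf k \<delta>" if "d < \<delta>" "\<delta> < 1" for \<delta>
    using strict_mono_onD[OF incr, of d \<delta>] pos[of \<delta>] d that by (cases "\<delta> < c") auto
  have "delta_0 k = d"
    unfolding delta_0_def
  proof (rule the_equality)
    fix \<delta> assume *: "delta_b k < \<delta> \<and> \<delta> < 1 \<and> Tf k \<delta> = 0"
    then have "\<not> \<delta> < d" "\<not> d < \<delta>" using neg[of \<delta>] pos'[of \<delta>] by auto
    then show "\<delta> = d" by simp
  qed (use d in auto)
  then show "delta_b k < delta_0 k" "delta_0 k < 1" "Tf k (delta_0 k) = 0"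
    and "delta_b k \<le> \<delta> \<Longrightarrow> \<delta> < delta_0 k \<Longrightarrow> Tf k \<delta> < 0"
    and "delta_0 k < \<delta> \<Longrightarrow> \<delta> < 1 \<Longrightarrow> 0 < Tf k \<delta>"
    and "delta_b k \<le> \<delta> \<Longrightarrow> \<delta> \<le> delta_0 k \<Longrightarrow> yf k \<delta> < - (1 + \<delta>) / 2"
    using d neg pos' y by auto
qed

text \<open>At \<open>\<delta> = 2 * k - 3\<close> the square in the identity for \<open>W\<close>
  vanishes, so \<open>T = - W\<close> there; \<open>W > 0\<close> then puts this point to the left
  of \<open>delta_0 k\<close>. The bound makes \<open>(\<delta> - 1) / 2 - b\<close> positive at
  \<open>delta_0 k\<close>.\<close>

lemma delta_0_greater: "2 * k - 3 < delta_0 k"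
proof -
  define c where "c = 2 - k"
  have c: "0 < c" "c < 1" and kc: "k = 2 - c" using k by (auto simp: c_def)
  \<comment> \<open>The leading term of the power series of the right-hand side, whose remaining
    terms are nonnegative.\<close>
  have "2 * c \<le> ln ((1 + c) / (1 - c))"
  proof -
    have "ln (1 + 0) - ln (1 - 0) - 2 * 0 \<le> ln (1 + c) - ln (1 - c) - 2 * c"
    proof (rule DERIV_nonneg_imp_nondecreasing[where f = "\<lambda>t. ln (1 + t) - ln (1 - t) - 2 * t"])
      fix t assume t: "0 \<le> t" "t \<le> c"
      then have "1 - t > 0" "1 + t > 0" using c by auto
      then have "((\<lambda>t. ln (1 + t) - ln (1 - t) - 2 * t) has_real_derivative
          1 / (1 + t) + 1 / (1 - t) - 2) (at t)"
        by (auto intro!: derivative_eq_intros)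
      moreover have "1 / (1 + t) + 1 / (1 - t) - 2 = 2 * t\<^sup>2 / ((1 + t) * (1 - t))"
        using \<open>1 - t > 0\<close> \<open>1 + t > 0\<close>
        by (simp add: divide_simps) (simp add: algebra_simps power2_eq_square)
      moreover have "\<dots> \<ge> 0" using \<open>1 - t > 0\<close> \<open>1 + t > 0\<close> by simp
      ultimately show "\<exists>y. ((\<lambda>t. ln (1 + t) - ln (1 - t) - 2 * t) has_real_derivative y) (at t) \<and> 0 \<le> y"
        by auto
    qed (use c in auto)
    then show ?thesis using c by (simp add: ln_div)
  qed
  then have "(1 + c) * (2 * c) \<le> (1 + c) * ln ((1 + c) / (1 - c))"
    using c by (intro mult_left_mono) auto
  then have "2 * c\<^sup>2 \<le> (1 + c) * ln ((1 + c) / (1 - c)) - 2 * c"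
    by (simp add: algebra_simps power2_eq_square)
  then have "2 * (2 - c) * (2 * c\<^sup>2) \<le> 2 * (2 - c) * ((1 + c) * ln ((1 + c) / (1 - c)) - 2 * c)"
    using c by (intro mult_left_mono) auto
  moreover have "Wf k (2 * k - 3) = 2 * (2 - c) * ((1 + c) * ln ((1 + c) / (1 - c)) - 2 * c) - 3 * c\<^sup>2"
    unfolding Wf_def kc by (simp add: power2_eq_square algebra_simps)
  moreover have "3 * c\<^sup>2 < 2 * (2 - c) * (2 * c\<^sup>2)"
  proof -
    \<comment> \<open>The factor is \<open>4 * (2 - c) - 3\<close>.\<close>
    have "0 < c\<^sup>2 * (5 - 4 * c)" using c by simp
    then show ?thesis by (simp add: algebra_simps)
  qed
  ultimately have "0 < Wf k (2 * k - 3)" by linarith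
  moreover have "((2 * k - 3 - 1) / 2 - bb k)\<^sup>2 = 0" by (simp add: field_simps)
  ultimately have "Tf k (2 * k - 3) < 0" using Wf_eq[of "2 * k - 3"] k by linarith
  then show ?thesis
    using Tf_pos[of "2 * k - 3"] delta_0(3) k by (cases "2 * k - 3" "delta_0 k" rule: linorder_cases) auto
qed

section \<open>The function \<open>W\<close> under the square root\<close>

text \<open>Before \<open>delta_0 k\<close> the term \<open>- T\<close> is positive; at
  \<open>delta_0 k\<close> the square is, by \<open>delta_0_greater\<close>. Positivity makes the
  square root differentiable up to both ends.\<close>

lemma Wf_pos: "0 < Wf k \<delta>" if "delta_b k \<le> \<delta>" "\<delta> \<le> delta_0 k"
proof (cases "\<delta> = delta_0 k")
  case True
  then show ?thesis using Wf_eq[of \<delta>] delta_0 delta_0_greater k by simp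
next
  case False
  then show ?thesis
    using Wf_eq[of \<delta>] Tf_neg[of \<delta>] delta_0 that k by (smt (verit) zero_le_power2)
qed

lemma DERIV_Wf:
  assumes "\<delta> < k"
  shows "(Wf k has_real_derivative yf k \<delta> + \<delta> - bb k) (at \<delta>)"
proof -
  have "((\<lambda>\<delta>. ((\<delta> - 1) / 2 - bb k)\<^sup>2 - Tf k \<delta>) has_real_derivative yf k \<delta> + \<delta> - bb k) (at \<delta>)"
    using assms by (auto intro!: derivative_eq_intros DERIV_Tf simp: field_simps)
  \<comment> \<open>The identity for \<open>W\<close> holds for \<open>\<delta> < k\<close>, an open
    condition, so the derivative carries over.\<close>
  then show ?thesis
    by (rule DERIV_cong_ev[THEN iffD1, rotated 3])
       (use assms eventually_nhds_in_open[of "{..<k}" \<delta>] in \<open>auto elim!: eventually_mono simp: Wf_eq\<close>)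
qed

text \<open>Where \<open>Tf k\<close> is nonpositive, \<open>sqrt (Wf k \<delta>) \<ge> (\<delta> - 1) / 2 - bb k\<close>, and this bounds the
  derivative of \<open>Wf k\<close> because \<open>Tf k\<close> is increasing.\<close>

lemma DERIV_Wf_less: "yf k \<delta> + \<delta> - bb k < sqrt (Wf k \<delta>)" if "delta_b k \<le> \<delta>" "\<delta> \<le> delta_0 k"
proof -
  have "yf k \<delta> + \<delta> - bb k < (\<delta> - 1) / 2 - bb k"
    using yf_less_delta_0[OF that] by (simp add: field_simps)
  also have "\<dots> \<le> sqrt (((\<delta> - 1) / 2 - bb k)\<^sup>2)" by simp
  also have "\<dots> \<le> sqrt (Wf k \<delta>)"
    by (rule real_sqrt_le_mono)
      (use Wf_eq[of \<delta>] Tf_neg[of \<delta>] delta_0 that k in \<open>cases "\<delta> = delta_0 k"; auto\<close>)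
  finally show ?thesis .
qed

section \<open>Existence, uniqueness and monotonicity of the pair \<open>(L, R)\<close>\<close>

lemma gap_eq_0_iff:
  assumes "R - L = 2 * (x + 1)"
  shows "gap k L R = 0 \<longleftrightarrow> Af k R - Af k L = x\<^sup>2 - 1"
proof -
  have "(R - L)\<^sup>2 / 4 - (R - L) = x\<^sup>2 - 1"
    unfolding assms by (simp add: power2_eq_square algebra_simps)
  then show ?thesis unfolding gap_def by auto
qed

lemma gap_refl [simp]: "gap k L L = 0"
  by (simp add: gap_def)

text \<open>Identifies \<open>delta_0 k\<close> as the left end of the pair whose right end is 1,
  that is, the pair at \<open>x_0 k\<close>.\<close>

lemma gap_1: "gap k \<delta> 1 = Tf k \<delta>"
  by (simp add: gap_def Tf_def power2_eq_square field_simps)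

text \<open>With the width \<open>h\<close> fixed, only \<open>A(t + h) - A(t)\<close> varies, at
  the positive rate \<open>y(t + h) - y(t)\<close>.\<close>

lemma gap_shift: "gap k L R < gap k L' R'"
  if "0 \<le> L" "L < R" "L < L'" "R' - L' = R - L" "R' \<le> 1"
proof -
  define h where "h = R - L"
  have h: "0 < h" "R = L + h" "R' = L' + h" using that by (auto simp: h_def)
  have "Af k (L + h) - Af k L < Af k (L' + h) - Af k L'"
  proof (rule DERIV_pos_imp_increasing[OF \<open>L < L'\<close>, where f = "\<lambda>t. Af k (t + h) - Af k t"])
    fix t assume t: "L \<le> t" "t \<le> L'"
    then have "((\<lambda>t. Af k (t + h) - Af k t) has_real_derivative yf k (t + h) - yf k t) (at t)"
      using that h k by (intro DERIV_diff DERIV_Af DERIV_shift[THEN iffD1]) auto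
    moreover have "yf k t < yf k (t + h)" using t that h by (subst yf_less_iff) auto
    ultimately show "\<exists>y. ((\<lambda>t. Af k (t + h) - Af k t) has_real_derivative y) (at t) \<and> 0 < y"
      by force
  qed
  then show ?thesis by (simp add: gap_def h)
qed

text \<open>In \<open>R\<close> the derivative is \<open>y(R) - (R - L) / 2 + 1\<close>, strictly
  increasing because the slope of \<open>y\<close> exceeds \<open>1 / 2\<close>. The first chord
  starts on the diagonal, where \<open>gap\<close> is zero.\<close>

lemma gap_slopes_right:
  "gap k L R / (R - L) < (gap k L R' - gap k L R) / (R' - R)"
  if "0 \<le> L" "L < R" "R < R'" "R' \<le> 1"
proof -
  have "(gap k L R - gap k L L) / (R - L) < (gap k L R' - gap k L R) / (R' - R)"
  proof (rule strictly_convex_slopes[where f = "gap k L"])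
    fix t assume t: "L \<le> t" "t \<le> R'"
    then show "(gap k L has_real_derivative yf k t - (t - L) / 2 + 1) (at t)"
      unfolding gap_def using that k
      by (auto intro!: derivative_eq_intros DERIV_Af simp: field_simps)
  next
    show "strict_mono_on {L..R'} (\<lambda>t. yf k t - (t - L) / 2 + 1)"
    proof (rule strict_mono_onI)
      fix s t assume "s \<in> {L..R'}" "t \<in> {L..R'}" "s < t"
      then show "yf k s - (s - L) / 2 + 1 < yf k t - (t - L) / 2 + 1"
        using zf_diff_ge[of s t] that by (simp add: yf_def field_simps)
    qed
  qed (use that in auto)
  then show ?thesis by simp
qed

text \<open>Concavity in \<open>L\<close>, obtained by applying the convex statement to the negated
  function.\<close>

lemma gap_slopes_left:
  "(gap k L' R - gap k L R) / (L - L') < gap k L R / (R - L)"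
  if "0 \<le> L'" "L' < L" "L < R" "R \<le> 1"
proof -
  have "(- gap k L R - - gap k L' R) / (L - L') < (- gap k R R - - gap k L R) / (R - L)"
  proof (rule strictly_convex_slopes[where f = "\<lambda>t. - gap k t R"])
    fix t assume t: "L' \<le> t" "t \<le> R"
    then show "((\<lambda>t. - gap k t R) has_real_derivative yf k t - (R - t) / 2 + 1) (at t)"
      unfolding gap_def using that k
      by (auto intro!: derivative_eq_intros DERIV_Af simp: field_simps)
  next
    show "strict_mono_on {L'..R} (\<lambda>t. yf k t - (R - t) / 2 + 1)"
    proof (rule strict_mono_onI)
      fix s t assume "s \<in> {L'..R}" "t \<in> {L'..R}" "s < t"
      then show "yf k s - (R - s) / 2 + 1 < yf k t - (R - t) / 2 + 1"
        using zf_diff_ge[of s t] that by (simp add: yf_def field_simps)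
    qed
  qed (use that in auto)
  then show ?thesis by simp
qed

lemma gap_pos_right: "0 < gap k L R'"
  if "gap k L R = 0" "0 \<le> L" "L < R" "R < R'" "R' \<le> 1"
  using gap_slopes_right[of L R R'] that by (simp add: zero_less_divide_iff)

lemma gap_neg_left: "gap k L' R < 0"
  if "gap k L R = 0" "0 \<le> L'" "L' < L" "L < R" "R \<le> 1"
  using gap_slopes_left[of L' L R] that by (simp add: divide_less_0_iff)

lemma x_0_less: "-1 < x_0 k" "x_0 k < bb k"
  using delta_0(1,2) delta_b_greater(1) by (auto simp: x_0_def field_simps)

text \<open>\<open>x\<close> fixes the width, and among intervals of equal width \<open>gap\<close>
  is strictly increasing under translation, so it has at most one zero.\<close>

lemma LR_unique:
  assumes "R - L = 2 * (x + 1)" "gap k L R = 0" "delta_b k \<le> L" "L < R" "R \<le> 1"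
  shows "LR k x = (L, R)"
  unfolding LR_def
proof (rule the_equality)
  show "case (L, R) of (L, R) \<Rightarrow> R - L = 2 * (x + 1) \<and> Af k R - Af k L = x\<^sup>2 - 1 \<and>
                         delta_b k \<le> L \<and> L < R \<and> R \<le> 1"
    using assms gap_eq_0_iff by auto
next
  fix p assume "case p of (L, R) \<Rightarrow> R - L = 2 * (x + 1) \<and> Af k R - Af k L = x\<^sup>2 - 1 \<and>
                         delta_b k \<le> L \<and> L < R \<and> R \<le> 1"
  then obtain L' R' where p: "p = (L', R')" "R' - L' = 2 * (x + 1)" "gap k L' R' = 0"
    "delta_b k \<le> L'" "L' < R'" "R' \<le> 1"
    using gap_eq_0_iff by (cases p) auto
  have "\<not> L < L'" "\<not> L' < L"
    using gap_shift[of L R L' R'] gap_shift[of L' R' L R] p assms delta_b(1) by auto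
  then show "p = (L, R)" using p assms by auto
qed

text \<open>The intermediate value theorem along intervals of fixed width \<open>h\<close>:
  \<open>gap\<close> is negative when \<open>L = delta_b k\<close> and nonnegative when
  \<open>R = 1\<close>.\<close>

lemma LR:
  assumes x: "-1 < x" "x \<le> x_0 k"
  obtains L R where "LR k x = (L, R)" "R - L = 2 * (x + 1)" "gap k L R = 0"
    "delta_b k \<le> L" "L < R" "R \<le> 1"
proof -
  define h where "h = 2 * (x + 1)"
  let ?d = "delta_b k"
  have h: "0 < h" "h \<le> 1 - delta_0 k"
    using x by (auto simp: h_def x_0_def field_simps)
  have cont_A: "continuous_on {..1} (Af k)"
    by (rule DERIV_continuous_on, rule has_field_derivative_at_within, rule DERIV_Af) (use k in auto)
  have "gap k ?d (?d + h) < 0"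
  proof (rule ccontr)
    \<comment> \<open>By convexity, a nonnegative value here would make \<open>gap\<close> increase
      further up to \<open>R = 1\<close>, where it equals \<open>T(delta_b k) < 0\<close>.\<close>
    assume "\<not> gap k ?d (?d + h) < 0"
    then have "0 \<le> gap k ?d (?d + h) / (?d + h - ?d)" using h by simp
    also have "\<dots> < (gap k ?d 1 - gap k ?d (?d + h)) / (1 - (?d + h))"
      by (rule gap_slopes_right) (use h delta_b delta_0 in auto)
    also have "\<dots> < 0"
      using \<open>\<not> gap k ?d (?d + h) < 0\<close> Tf_delta_b gap_1 h delta_0
      by (intro divide_neg_pos) auto
    finally show False .
  qed
  moreover have "0 \<le> Tf k (1 - h)"
    using Tf_pos[of "1 - h"] delta_0 h by (cases "1 - h = delta_0 k") auto
  then have "0 \<le> gap k (1 - h) (1 - h + h)" by (simp add: gap_1)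
  moreover have "continuous_on {?d..1 - h} (\<lambda>t. gap k t (t + h))"
    unfolding gap_def using h
    by (intro continuous_intros continuous_on_compose2[OF cont_A]) auto
  ultimately obtain L where L: "?d \<le> L" "L \<le> 1 - h" "gap k L (L + h) = 0"
    using IVT'[of "\<lambda>t. gap k t (t + h)" ?d 0 "1 - h"] delta_0 h by auto
  show ?thesis
    by (rule that[OF LR_unique[of "L + h" L x]]) (use L h in \<open>auto simp: h_def\<close>)
qed

lemma LR_x_0: "LR k (x_0 k) = (delta_0 k, 1)"
  by (rule LR_unique) (use delta_0 in \<open>auto simp: gap_1 x_0_def field_simps\<close>)

lemma LR_mono:
  assumes "-1 < x" "x \<le> x'" "x' \<le> x_0 k"
  shows "fst (LR k x') \<le> fst (LR k x)" "snd (LR k x) \<le> snd (LR k x')"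
proof -
  obtain L R where LR1: "LR k x = (L, R)" "R - L = 2 * (x + 1)" "gap k L R = 0"
    "delta_b k \<le> L" "L < R" "R \<le> 1"
    using LR[of x] assms by auto
  obtain L' R' where LR2: "LR k x' = (L', R')" "R' - L' = 2 * (x' + 1)" "gap k L' R' = 0"
    "delta_b k \<le> L'" "L' < R'" "R' \<le> 1"
    using LR[of x'] assms by auto
  show "fst (LR k x') \<le> fst (LR k x)"
  proof (rule ccontr)
    assume "\<not> fst (LR k x') \<le> fst (LR k x)"
    then have "L < L'" using LR1(1) LR2(1) by simp
    \<comment> \<open>\<open>[L, R'']\<close> has the width of \<open>[L', R']\<close>. Widening
      from a zero and then translating to the right can only raise \<open>gap\<close>, and the
      translation does so strictly.\<close>
    define R'' where "R'' = L + (R' - L')"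
    have "R \<le> R''" using LR1(2) LR2(2) assms by (simp add: R''_def)
    then have "0 \<le> gap k L R''"
      using gap_pos_right[of L R R''] LR1 LR2 \<open>L < L'\<close> delta_b(1)
      by (cases "R = R''") (auto simp: R''_def)
    also have "\<dots> < gap k L' R'"
      by (rule gap_shift) (use LR1 LR2 \<open>L < L'\<close> delta_b(1) in \<open>auto simp: R''_def\<close>)
    finally show False using LR2 by simp
  qed
  show "snd (LR k x) \<le> snd (LR k x')"
  proof (rule ccontr)
    assume "\<not> snd (LR k x) \<le> snd (LR k x')"
    then have "R' < R" using LR1(1) LR2(1) by simp
    \<comment> \<open>The mirror image: \<open>[L'', R]\<close> has the width of
      \<open>[L', R']\<close>, and concavity in \<open>L\<close> gives the sign.\<close>
    define L'' where "L'' = R - (R' - L')"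
    have "L'' \<le> L" using LR1(2) LR2(2) assms by (simp add: L''_def)
    have "gap k L' R' < gap k L'' R"
      by (rule gap_shift) (use LR1 LR2 \<open>R' < R\<close> delta_b(1) in \<open>auto simp: L''_def\<close>)
    also have "\<dots> \<le> 0"
      using gap_neg_left[of L R L''] LR1 LR2 \<open>R' < R\<close> \<open>L'' \<le> L\<close> delta_b(1)
      by (cases "L'' = L") (auto simp: L''_def)
    finally show False using LR2 by simp
  qed
qed

text \<open>As \<open>yf k\<close> has slope at least 1, its mean value \<open>(R - L) / 4 - 1\<close> over \<open>[L, R]\<close> exceeds
  \<open>yf k L\<close>, and is exceeded by \<open>yf k R\<close>, by at least \<open>(R - L) / 2\<close>.\<close>

lemma yf_gap_bounds:
  assumes "gap k L R = 0" "0 \<le> L" "L < R" "R \<le> 1"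
  shows "yf k L \<le> -1" "-1 \<le> yf k R"
proof -
  \<comment> \<open>The mean value theorem is applied to \<open>A(t) - t^2 / 2\<close> because its
    derivative \<open>y(t) - t\<close> is nondecreasing.\<close>
  have "\<exists>\<xi>. L < \<xi> \<and> \<xi> < R \<and> (Af k R - R\<^sup>2 / 2) - (Af k L - L\<^sup>2 / 2) = (R - L) * (yf k \<xi> - \<xi>)"
    using assms k
    by (intro MVT2[OF \<open>L < R\<close>]) (auto intro!: derivative_eq_intros DERIV_Af)
  then obtain \<xi> where \<xi>: "L < \<xi>" "\<xi> < R"
    "(Af k R - R\<^sup>2 / 2) - (Af k L - L\<^sup>2 / 2) = (R - L) * (yf k \<xi> - \<xi>)"
    by blast
  have "(R - L) * (yf k \<xi> - \<xi>) = (R - L) * ((R - L) / 4 - 1 - (R + L) / 2)"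
    unfolding \<xi>(3)[symmetric] using assms(1) by (simp add: gap_def power2_eq_square field_simps)
  then have "yf k \<xi> - \<xi> = (R - L) / 4 - 1 - (R + L) / 2"
    using \<open>L < R\<close> by simp
  moreover have "yf k L - L \<le> yf k \<xi> - \<xi>" "yf k \<xi> - \<xi> \<le> yf k R - R"
    using zf_diff_ge[of L \<xi>] zf_diff_ge[of \<xi> R] \<xi> assms by (auto simp: yf_def)
  ultimately show "yf k L \<le> -1" "-1 \<le> yf k R"
    using \<open>L < R\<close> by (auto simp: field_simps)
qed

lemma yf_mono: "0 \<le> s \<Longrightarrow> s \<le> t \<Longrightarrow> t \<le> 1 \<Longrightarrow> yf k s \<le> yf k t"
  using zf_diff_ge[of s t] by (simp add: yf_def)

text \<open>\<open>R - L\<close> grows at rate 2 in \<open>x\<close>, so each endpoint moves at most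
  at that rate, and the slope of \<open>y\<close> is at most \<open>(k + 1) / (k - 1)\<close>; the
  product is \<open>C\<close>.\<close>

lemma left_piece:
  assumes x: "-1 \<le> x" "x \<le> x'" "x' \<le> x_0 k"
  defines "C \<equiv> 2 * ((k + 1) / (k - 1))"
  shows "D1 k x' \<le> D1 k x" "U1 k x \<le> U1 k x'"
    "D1 k x - D1 k x' \<le> C * (x' - x)" "U1 k x' - U1 k x \<le> C * (x' - x)"
proof -
  define C' where "C' = (k + 1) / (k - 1)"
  have C: "C = 2 * C'" "0 < C'" using k by (auto simp: C_def C'_def)
  have "D1 k x' \<le> D1 k x \<and> U1 k x \<le> U1 k x' \<and>
    D1 k x - D1 k x' \<le> C * (x' - x) \<and> U1 k x' - U1 k x \<le> C * (x' - x)"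
  proof (cases "x = x'")
    case True
    then show ?thesis by simp
  next
    case False
    obtain L' R' where LR2: "LR k x' = (L', R')" "R' - L' = 2 * (x' + 1)" "gap k L' R' = 0"
      "delta_b k \<le> L'" "L' < R'" "R' \<le> 1"
      using LR[of x'] False x by auto
    have DU': "D1 k x' = yf k L'" "U1 k x' = yf k R'"
      using False x LR2(1) by (auto simp: D1_def U1_def)
    show ?thesis
    proof (cases "x = -1")
      case True
      \<comment> \<open>At \<open>x = -1\<close> both maps equal -1, which lies between
        \<open>y(L')\<close> and \<open>y(R')\<close>; hence \<open>y(R') - y(L')\<close> bounds
        both increments.\<close>
      have "yf k L' \<le> -1" "-1 \<le> yf k R'"
        by (rule yf_gap_bounds[of L' R']; use LR2 delta_b(1) in auto)+
      moreover have "yf k R' - yf k L' \<le> C * (x' - x)"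
        using zf_diff_le[of L' R', folded C'_def] LR2 delta_b(1) True
        by (simp add: yf_def C algebra_simps)
      ultimately show ?thesis using True by (simp add: DU') (simp add: D1_def U1_def)
    next
      case False
      then obtain L R where LR1: "LR k x = (L, R)" "R - L = 2 * (x + 1)" "gap k L R = 0"
        "delta_b k \<le> L" "L < R" "R \<le> 1"
        using LR[of x] x by auto
      have DU: "D1 k x = yf k L" "U1 k x = yf k R"
        using False x LR1(1) by (auto simp: D1_def U1_def)
      have le: "L' \<le> L" "R \<le> R'"
        using LR_mono[of x x'] False x LR1(1) LR2(1) by auto
      then have "L - L' \<le> 2 * (x' - x)" "R' - R \<le> 2 * (x' - x)"
        using LR1(2) LR2(2) by auto
      then have "C' * (L - L') \<le> C' * (2 * (x' - x))" "C' * (R' - R) \<le> C' * (2 * (x' - x))"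
        using C by (simp_all add: mult_left_mono)
      moreover have "yf k L - yf k L' \<le> C' * (L - L')" "yf k R' - yf k R \<le> C' * (R' - R)"
        using zf_diff_le[of L' L] zf_diff_le[of R R'] le LR1 LR2 delta_b(1)
        by (auto simp: yf_def C'_def)
      moreover have "yf k L' \<le> yf k L" "yf k R \<le> yf k R'"
        using yf_mono[of L' L] yf_mono[of R R'] le LR1 LR2 delta_b(1) by auto
      ultimately show ?thesis by (simp add: DU DU' C algebra_simps)
    qed
  qed
  then show "D1 k x' \<le> D1 k x" "U1 k x \<le> U1 k x'"
    "D1 k x - D1 k x' \<le> C * (x' - x)" "U1 k x' - U1 k x \<le> C * (x' - x)"
    by blast+
qed

lemma continuous_left_piece:
  "continuous_on {-1..x_0 k} (D1 k)" "continuous_on {-1..x_0 k} (U1 k)"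
proof -
  have C: "0 \<le> 2 * ((k + 1) / (k - 1))" using k by simp
  show "continuous_on {-1..x_0 k} (D1 k)" "continuous_on {-1..x_0 k} (U1 k)"
    by (rule continuous_on_lipschitz_Icc[OF C]; use left_piece in force)+
qed

lemma mono_left_piece:
  "antimono_on {-1..x_0 k} (D1 k)" "mono_on {-1..x_0 k} (U1 k)"
  by (rule monotone_onI; use left_piece in force)+

section \<open>The middle piece, parametrized by \<open>\<delta>\<close>\<close>

abbreviation (input) "midX \<delta> \<equiv> bb k - \<delta> + sqrt (Wf k \<delta>)"
abbreviation (input) "midU \<delta> \<equiv> bb k - \<delta> + 2 * sqrt (Wf k \<delta>)"

lemma midX_ends: "midX (delta_b k) = bb k" "midX (delta_0 k) = x_0 k"
  and midU_ends: "midU (delta_b k) = bb k + delta_b k" "midU (delta_0 k) = 1 - k"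
proof -
  \<comment> \<open>\<open>T\<close> vanishes at \<open>delta_0 k\<close>, so \<open>W\<close> is a
    perfect square there, and \<open>delta_0_greater\<close> fixes the sign of its root.\<close>
  have "sqrt (Wf k (delta_0 k)) = (delta_0 k - 1) / 2 - bb k"
    using Wf_eq[of "delta_0 k"] delta_0 delta_0_greater k by simp
  then show "midX (delta_0 k) = x_0 k" "midU (delta_0 k) = 1 - k"
    by (auto simp: x_0_def field_simps)
  show "midX (delta_b k) = bb k" "midU (delta_b k) = bb k + delta_b k"
    using delta_b(1) by (auto simp: Wf_delta_b)
qed

text \<open>The bound \<open>1 / 2\<close> is exactly what makes the derivative
  \<open>-1 + 2 * m\<close> of \<open>midU\<close> negative.\<close>

lemma DERIV_sqrt_Wf:
  assumes "delta_b k \<le> \<delta>" "\<delta> \<le> delta_0 k"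
  obtains m where "((\<lambda>\<delta>. sqrt (Wf k \<delta>)) has_real_derivative m) (at \<delta>)" "m < 1 / 2"
proof
  let ?m = "(yf k \<delta> + \<delta> - bb k) / (2 * sqrt (Wf k \<delta>))"
  have W: "0 < Wf k \<delta>" using Wf_pos assms by blast
  have "\<delta> < k" using assms delta_0(2) k by simp
  show "((\<lambda>\<delta>. sqrt (Wf k \<delta>)) has_real_derivative ?m) (at \<delta>)"
    using W by (auto intro!: derivative_eq_intros DERIV_Wf[OF \<open>\<delta> < k\<close>] simp: divide_simps)
  show "?m < 1 / 2"
    using DERIV_Wf_less[OF assms] W by (simp add: divide_simps)
qed

lemma midX_midU_antimono:
  "strict_antimono_on {delta_b k..delta_0 k} midX" "antimono_on {delta_b k..delta_0 k} midU"
proof -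
  have "midX t < midX s \<and> midU t < midU s"
    if "delta_b k \<le> s" "s < t" "t \<le> delta_0 k" for s t
  proof
    show "midU t < midU s"
    proof (rule DERIV_neg_imp_decreasing[OF \<open>s < t\<close>])
      fix x assume "s \<le> x" "x \<le> t"
      then have "delta_b k \<le> x" "x \<le> delta_0 k" using that by auto
      then obtain m where m: "((\<lambda>\<delta>. sqrt (Wf k \<delta>)) has_real_derivative m) (at x)" "m < 1 / 2"
        by (rule DERIV_sqrt_Wf)
      have "(midU has_real_derivative 0 - 1 + 2 * m) (at x)"
        by (intro DERIV_add DERIV_diff DERIV_const DERIV_ident DERIV_cmult m)
      then show "\<exists>y. (midU has_real_derivative y) (at x) \<and> y < 0"
        using m(2) by (intro exI[of _ "0 - 1 + 2 * m"]) auto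
    qed
    \<comment> \<open>\<open>midX\<close> is the mean of \<open>midU\<close> and the decreasing
      function \<open>b - \<delta>\<close>.\<close>
    then show "midX t < midX s" using \<open>s < t\<close> by simp
  qed
  then show "strict_antimono_on {delta_b k..delta_0 k} midX"
    "antimono_on {delta_b k..delta_0 k} midU"
    by (auto simp: monotone_on_def le_less)
qed

lemma continuous_sqrt_Wf: "continuous_on {delta_b k..delta_0 k} (\<lambda>\<delta>. sqrt (Wf k \<delta>))"
proof (intro continuous_intros)
  show "continuous_on {delta_b k..delta_0 k} (Wf k)"
    by (rule DERIV_continuous_on, rule has_field_derivative_at_within, rule DERIV_Wf)
      (use delta_0 k in auto)
qed

lemma par_mid1:
  "par_mid1 k ` {x_0 k..bb k} = {delta_b k..delta_0 k}"
  "continuous_on {x_0 k..bb k} (par_mid1 k)" "antimono_on {x_0 k..bb k} (par_mid1 k)"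
  "par_mid1 k (bb k) = delta_b k" "par_mid1 k (x_0 k) = delta_0 k"
proof -
  have "continuous_on {delta_b k..delta_0 k} midX"
    by (intro continuous_intros continuous_sqrt_Wf)
  note * = the_inv_into_strict_antimono[OF this midX_midU_antimono(1) less_imp_le[OF delta_0(1)],
      folded par_mid1_def, unfolded midX_ends]
  show "par_mid1 k ` {x_0 k..bb k} = {delta_b k..delta_0 k}"
    "continuous_on {x_0 k..bb k} (par_mid1 k)" "antimono_on {x_0 k..bb k} (par_mid1 k)"
    "par_mid1 k (bb k) = delta_b k" "par_mid1 k (x_0 k) = delta_0 k"
    by (fact *)+
qed

text \<open>At \<open>x_0 k\<close> the definitions use the left piece, so agreement must be checked
  there: the pair is \<open>(delta_0 k, 1)\<close> and \<open>y(1) = 1 - k\<close>.\<close>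

lemma mid_piece:
  assumes "x_0 k \<le> x" "x \<le> bb k"
  shows "D1 k x = yf k (par_mid1 k x)" "U1 k x = midU (par_mid1 k x)"
proof -
  have "D1 k x = yf k (par_mid1 k x) \<and> U1 k x = midU (par_mid1 k x)"
  proof (cases "x = x_0 k")
    case True
    then show ?thesis
      using x_0_less LR_x_0 midU_ends by (simp add: D1_def U1_def par_mid1 yf_1)
  next
    case False
    then show ?thesis
      using assms x_0_less by (simp add: D1_def U1_def yf_def)
  qed
  then show "D1 k x = yf k (par_mid1 k x)" "U1 k x = midU (par_mid1 k x)" by auto
qed

lemma par_mid1_range: "x_0 k \<le> x \<Longrightarrow> x \<le> bb k \<Longrightarrow> par_mid1 k x \<in> {delta_b k..delta_0 k}"
  unfolding par_mid1(1)[symmetric] by auto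

lemma continuous_mid_piece:
  "continuous_on {x_0 k..bb k} (D1 k)" "continuous_on {x_0 k..bb k} (U1 k)"
proof -
  have "continuous_on {x_0 k..bb k} (\<lambda>x. yf k (par_mid1 k x))"
    unfolding yf_def using par_mid1_range delta_b(1) delta_0(2)
    by (intro continuous_intros continuous_on_compose2[OF continuous_zf par_mid1(2)]) fastforce
  then show "continuous_on {x_0 k..bb k} (D1 k)"
    by (rule continuous_on_eq) (simp add: mid_piece)
  have "continuous_on {x_0 k..bb k} (\<lambda>x. midU (par_mid1 k x))"
    using par_mid1_range
    by (intro continuous_intros continuous_on_compose2[OF continuous_sqrt_Wf par_mid1(2)] par_mid1(2)) auto
  then show "continuous_on {x_0 k..bb k} (U1 k)"
    by (rule continuous_on_eq) (simp add: mid_piece)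
qed

lemma mono_mid_piece:
  "antimono_on {x_0 k..bb k} (D1 k)" "mono_on {x_0 k..bb k} (U1 k)"
proof -
  have "D1 k y \<le> D1 k x \<and> U1 k x \<le> U1 k y" if xy: "x_0 k \<le> x" "x \<le> y" "y \<le> bb k" for x y
  proof -
    have g: "par_mid1 k y \<le> par_mid1 k x" using par_mid1(3) xy by (auto simp: monotone_on_def)
    have r: "par_mid1 k x \<in> {delta_b k..delta_0 k}" "par_mid1 k y \<in> {delta_b k..delta_0 k}"
      using par_mid1_range xy by auto
    have "D1 k y \<le> D1 k x"
      using yf_mono[OF _ g] r delta_b(1) delta_0(2) xy by (simp add: mid_piece)
    moreover have "U1 k x \<le> U1 k y"
      using monotone_onD[OF midX_midU_antimono(2) r(2,1) g] xy by (simp add: mid_piece)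
    ultimately show ?thesis ..
  qed
  then show "antimono_on {x_0 k..bb k} (D1 k)" "mono_on {x_0 k..bb k} (U1 k)"
    by (auto simp: monotone_on_def)
qed

section \<open>The right piece and the assembly of the three pieces\<close>

lemma par_right1:
  "par_right1 k ` {bb k..1} = {delta_b k..1}"
  "continuous_on {bb k..1} (par_right1 k)" "mono_on {bb k..1} (par_right1 k)"
  "par_right1 k (bb k) = delta_b k"
proof -
  have "continuous_on {delta_b k..1} (zf k)" "strict_mono_on {delta_b k..1} (zf k)"
    using continuous_on_subset[OF continuous_zf] monotone_on_subset[OF strict_mono_zf] delta_b(1)
    by auto
  note * = the_inv_into_strict_mono[OF this less_imp_le[OF delta_b(2)],
      folded par_right1_def, unfolded delta_b(3) zf_1]
  show "par_right1 k ` {bb k..1} = {delta_b k..1}"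
    "continuous_on {bb k..1} (par_right1 k)" "mono_on {bb k..1} (par_right1 k)"
    "par_right1 k (bb k) = delta_b k"
    by (fact *)+
qed

text \<open>At \<open>b\<close> the middle piece supplies the values; there
  \<open>D = y(delta_b k) = -2 = b - k\<close> and \<open>U = b + delta_b k\<close>.\<close>

lemma right_piece:
  assumes "bb k \<le> x" "x \<le> 1"
  shows "D1 k x = x - k" "U1 k x = x + par_right1 k x"
proof -
  have "D1 k x = x - k \<and> U1 k x = x + par_right1 k x"
  proof (cases "x = bb k")
    case True
    then show ?thesis
      using mid_piece[of x] x_0_less midU_ends
      by (simp add: par_mid1 par_right1 yf_delta_b)
  next
    case False
    then show ?thesis using assms x_0_less by (simp add: D1_def U1_def)
  qed
  then show "D1 k x = x - k" "U1 k x = x + par_right1 k x" by auto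
qed

lemma x_0_le: "-1 \<le> x_0 k" "x_0 k \<le> bb k" "-1 \<le> bb k" "bb k \<le> 1"
  using x_0_less k by auto

lemma continuous_D1: "continuous_on {-1..1} (D1 k)"
proof (rule continuous_on_glue[of _ "bb k"], rule continuous_on_glue[of _ "x_0 k"])
  show "continuous_on {bb k..1} (D1 k)"
    by (rule continuous_on_eq[where f = "\<lambda>x. x - k"], intro continuous_intros) (simp add: right_piece)
qed (fact continuous_left_piece continuous_mid_piece x_0_le)+

lemma continuous_U1: "continuous_on {-1..1} (U1 k)"
proof (rule continuous_on_glue[of _ "bb k"], rule continuous_on_glue[of _ "x_0 k"])
  show "continuous_on {bb k..1} (U1 k)"
    by (rule continuous_on_eq[where f = "\<lambda>x. x + par_right1 k x"],
        intro continuous_intros par_right1(2)) (simp add: right_piece)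
qed (fact continuous_left_piece continuous_mid_piece x_0_le)+

lemma antimono_D1: "antimono_on {-1..bb k} (D1 k)"
  by (rule monotone_on_glue[OF mono_left_piece(1) mono_mid_piece(1) _ x_0_le(1,2)])
    (simp add: transp_on_def)

lemma mono_U1: "mono_on {-1..1} (U1 k)"
proof (rule monotone_on_glue[of _ "bb k"], rule monotone_on_glue[of _ "x_0 k"])
  show "mono_on {bb k..1} (U1 k)"
  proof (rule monotone_onI)
    fix x y assume "x \<in> {bb k..1}" "y \<in> {bb k..1}" "x \<le> y"
    then show "U1 k x \<le> U1 k y"
      using monotone_onD[OF par_right1(3), of x y] by (simp add: right_piece)
  qed
qed (fact mono_left_piece mono_mid_piece x_0_le transp_on_le)+

lemma left_monotone_coupling_case1: "left_monotone k (measure_support (coupling k))"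
proof (rule left_monotone_coupling)
  have DU: "lowD k = D1 k" "upU k = U1 k"
    using k by (auto simp: lowD_def upU_def)
  show "continuous_on {-1..1} (lowD k)" "continuous_on {-1..1} (upU k)"
    "antimono_on {-1..bb k} (lowD k)" "mono_on {-1..1} (upU k)"
    unfolding DU by (fact continuous_D1 continuous_U1 antimono_D1 mono_U1)+
  show "lowD k (-1) \<le> upU k (-1)"
    by (simp add: DU D1_def U1_def)
  show "lowD k x = x - k \<and> x - k \<le> upU k x" if "bb k \<le> x" "x \<le> 1" for x
  proof -
    have "par_right1 k x \<in> {delta_b k..1}" unfolding par_right1(1)[symmetric] using that by auto
    then show ?thesis using that delta_b(1) k by (simp add: DU right_piece)
  qed
qed (fact x_0_le)+

end

section \<open>The case \<open>2 \<le> k < 3\<close>\<close>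

context
  fixes k :: real
  assumes k: "2 \<le> k" "k < 3"
begin

section \<open>The functions \<open>E\<close>, \<open>\<rho>\<close> and \<open>R\<close>\<close>

lemma DERIV_Ef: "(Ef k has_real_derivative - (Ef k \<eta> / (2 * k))) (at \<eta>)"
  unfolding Ef_def using k by (auto intro!: derivative_eq_intros simp: field_simps)

lemma continuous_Ef: "continuous_on S (Ef k)"
  by (rule DERIV_continuous_on, rule has_field_derivative_at_within, rule DERIV_Ef)

lemma Ef_pos: "0 < Ef k \<eta>"
  using k by (simp add: Ef_def)

lemma Ef_antimono: "s < t \<Longrightarrow> Ef k t < Ef k s"
  using k by (auto simp: Ef_def intro!: mult_strict_left_mono divide_strict_right_mono)

lemma Ef_2: "Ef k 2 = k - 1"
  by (simp add: Ef_def)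

text \<open>As \<open>E\<close> decreases, the case \<open>\<eta> = b\<close> suffices; it is
  \<open>ln_ratio_less\<close> in exponential form. The bound makes
  \<open>\<rho>' = 1 - E / (2 * k)\<close> positive and fixes the sign of a root at
  \<open>eta_b k\<close>.\<close>

lemma Ef_less: "Ef k \<eta> < k" if "bb k \<le> \<eta>"
proof -
  have "ln ((k - 1) / k) < (k - 4) / (2 * k)"
    using ln_ratio_less[of k] k by (simp add: pos_less_divide_eq mult.commute)
  then have "(k - 1) / k < exp ((k - 4) / (2 * k))"
    using k by (metis divide_pos_pos exp_less_mono exp_ln diff_gt_0_iff_gt less_le_trans
        one_less_numeral_iff semiring_norm(76) zero_less_numeral)
  then have "(k - 1) / k * exp ((4 - k) / (2 * k)) < exp ((k - 4) / (2 * k)) * exp ((4 - k) / (2 * k))"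
    by (intro mult_strict_right_mono) auto
  also have "\<dots> = exp ((k - 4) / (2 * k) + (4 - k) / (2 * k))" by (rule exp_add[symmetric])
  also have "(k - 4) / (2 * k) + (4 - k) / (2 * k) = 0" using k by (simp add: field_simps)
  finally have "Ef k (bb k) < k" using k by (simp add: Ef_def field_simps)
  then show ?thesis using Ef_antimono[of "bb k" \<eta>] that by (cases "\<eta> = bb k") auto
qed

lemma strict_mono_rho: "strict_mono_on {bb k..2} (rho k)"
proof (rule strict_mono_on_deriv_pos)
  fix \<eta> assume "bb k \<le> \<eta>" "\<eta> \<le> 2"
  then show "(rho k has_real_derivative 1 - Ef k \<eta> / (2 * k)) (at \<eta>) \<and> 0 < 1 - Ef k \<eta> / (2 * k)"
    unfolding rho_def using Ef_less[of \<eta>] k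
    by (auto intro!: derivative_eq_intros DERIV_Ef)
qed

lemma continuous_rho: "continuous_on S (rho k)"
  unfolding rho_def by (intro continuous_intros continuous_Ef)

lemma rho_2: "rho k 2 = 1"
  by (simp add: rho_def Ef_2)

lemma eta_b: "bb k < eta_b k" "eta_b k < 2" "rho k (eta_b k) = bb k"
proof -
  have less: "rho k (bb k) < bb k" using Ef_less[of "bb k"] by (simp add: rho_def)
  obtain e where e: "bb k \<le> e" "e \<le> 2" "rho k e = bb k"
    using IVT'[of "rho k" "bb k" "bb k" 2] less rho_2 k continuous_rho by auto
  have "e \<noteq> bb k" "e \<noteq> 2" using e less rho_2 k by auto
  then have "\<exists>!\<eta>. bb k < \<eta> \<and> \<eta> < 2 \<and> rho k \<eta> = bb k"
    using e strict_mono_on_eqD[OF strict_mono_rho] by (intro ex1I[of _ e]) auto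
  from theI'[OF this] show "bb k < eta_b k" "eta_b k < 2" "rho k (eta_b k) = bb k"
    by (auto simp: eta_b_def)
qed

text \<open>The comparison is made under the root, which vanishes at \<open>\<eta> = 2\<close> when
  \<open>k = 2\<close>. The radicand is nonincreasing because
  \<open>\<eta> + 2 \<le> 4 \<le> 2 * k\<close>.\<close>

lemma Rf_antimono: "Rf k t \<le> Rf k s" if "s \<le> t" "t \<le> 2"
proof -
  have "(\<lambda>\<eta>. k\<^sup>2 - (\<eta> + 2) * Ef k \<eta>) t \<le> (\<lambda>\<eta>. k\<^sup>2 - (\<eta> + 2) * Ef k \<eta>) s"
  proof (rule DERIV_nonpos_imp_nonincreasing[OF \<open>s \<le> t\<close>])
    fix x assume x: "s \<le> x" "x \<le> t"
    have "((\<lambda>\<eta>. k\<^sup>2 - (\<eta> + 2) * Ef k \<eta>) has_real_derivative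
        - (Ef k x * (1 - (x + 2) / (2 * k)))) (at x)"
      using k by (auto intro!: derivative_eq_intros DERIV_Ef simp: field_simps)
    moreover have "0 \<le> 1 - (x + 2) / (2 * k)" using x that k by simp
    then have "- (Ef k x * (1 - (x + 2) / (2 * k))) \<le> 0" using Ef_pos[of x] by simp
    ultimately show "\<exists>y. ((\<lambda>\<eta>. k\<^sup>2 - (\<eta> + 2) * Ef k \<eta>) has_real_derivative y) (at x) \<and> y \<le> 0"
      by blast
  qed
  then show ?thesis by (simp add: Rf_def)
qed

lemma continuous_Rf: "continuous_on S (Rf k)"
  unfolding Rf_def by (intro continuous_intros continuous_Ef)

text \<open>Both radicands are perfect squares; at \<open>eta_b k\<close> this follows from
  \<open>\<eta> + 2 = 2 * k - E\<close>, a form of \<open>\<rho>(\<eta>) = b\<close>.\<close>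

lemma Rf_ends: "Rf k 2 = k - 2" "Rf k (eta_b k) = k - Ef k (eta_b k)"
proof -
  have "k\<^sup>2 - (2 + 2) * Ef k 2 = (k - 2)\<^sup>2"
    by (simp add: Ef_2 power2_eq_square algebra_simps)
  then show "Rf k 2 = k - 2" using k by (simp add: Rf_def)
  have "eta_b k = 2 * k - 2 - Ef k (eta_b k)" using eta_b(3) by (simp add: rho_def)
  then have "eta_b k + 2 = 2 * k - Ef k (eta_b k)" by simp
  then have "k\<^sup>2 - (eta_b k + 2) * Ef k (eta_b k) = (k - Ef k (eta_b k))\<^sup>2"
    by (simp only:) (simp add: power2_eq_square algebra_simps)
  then show "Rf k (eta_b k) = k - Ef k (eta_b k)"
    using Ef_less[of "eta_b k"] eta_b(1) by (simp add: Rf_def)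
qed

section \<open>The three pieces for \<open>k \<ge> 2\<close> and their assembly\<close>

lemma par_mid2:
  "par_mid2 k ` {aa k..bb k} = {eta_b k..2}"
  "continuous_on {aa k..bb k} (par_mid2 k)" "antimono_on {aa k..bb k} (par_mid2 k)"
  "par_mid2 k (bb k) = eta_b k" "par_mid2 k (aa k) = 2"
proof -
  let ?X = "\<lambda>\<eta>. Ef k \<eta> - 2 + Rf k \<eta>"
  have X: "?X (eta_b k) = bb k" "?X 2 = aa k" using Rf_ends Ef_2 by auto
  have cont: "continuous_on {eta_b k..2} ?X"
    by (intro continuous_intros continuous_Ef continuous_Rf)
  have antimono: "strict_antimono_on {eta_b k..2} ?X"
  proof (rule monotone_onI)
    fix s t assume "s \<in> {eta_b k..2}" "t \<in> {eta_b k..2}" "s < t"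
    then show "?X t < ?X s" using Ef_antimono[of s t] Rf_antimono[of s t] by auto
  qed
  note * = the_inv_into_strict_antimono[OF cont antimono less_imp_le[OF eta_b(2)],
      folded par_mid2_def, unfolded X]
  show "par_mid2 k ` {aa k..bb k} = {eta_b k..2}"
    "continuous_on {aa k..bb k} (par_mid2 k)" "antimono_on {aa k..bb k} (par_mid2 k)"
    "par_mid2 k (bb k) = eta_b k" "par_mid2 k (aa k) = 2"
    by (fact *)+
qed

lemma par_right2:
  "par_right2 k ` {bb k..1} = {eta_b k..2}"
  "continuous_on {bb k..1} (par_right2 k)" "mono_on {bb k..1} (par_right2 k)"
  "par_right2 k (bb k) = eta_b k"
proof -
  have "strict_mono_on {eta_b k..2} (rho k)"
    using monotone_on_subset[OF strict_mono_rho] eta_b(1) by auto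
  note * = the_inv_into_strict_mono[OF continuous_rho this less_imp_le[OF eta_b(2)],
      folded par_right2_def, unfolded eta_b(3) rho_2]
  show "par_right2 k ` {bb k..1} = {eta_b k..2}"
    "continuous_on {bb k..1} (par_right2 k)" "mono_on {bb k..1} (par_right2 k)"
    "par_right2 k (bb k) = eta_b k"
    by (fact *)+
qed

text \<open>Writing \<open>D\<close> through \<open>\<rho>\<close> reduces its monotonicity to that
  of \<open>\<rho>\<close>. At \<open>x = a\<close> the affine formulas apply and give the values at
  \<open>\<eta> = 2\<close>.\<close>

lemma mid_piece2:
  assumes "aa k \<le> x" "x \<le> bb k"
  shows "D2 k x = rho k (par_mid2 k x) - k" "U2 k x = Ef k (par_mid2 k x) - 2 + 2 * Rf k (par_mid2 k x)"
proof -
  have "D2 k x = rho k (par_mid2 k x) - k \<and>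
    U2 k x = Ef k (par_mid2 k x) - 2 + 2 * Rf k (par_mid2 k x)"
  proof (cases "x = aa k")
    case True
    have "par_mid2 k x = 2" unfolding True by (rule par_mid2)
    moreover have "D2 k x = 1 - k" "U2 k x = 3 * k - 7"
      unfolding True by (simp_all add: D2_def U2_def field_simps)
    ultimately show ?thesis by (simp add: Rf_ends Ef_2 rho_2)
  next
    case False
    then show ?thesis using assms by (simp add: D2_def U2_def rho_def)
  qed
  then show "D2 k x = rho k (par_mid2 k x) - k"
    "U2 k x = Ef k (par_mid2 k x) - 2 + 2 * Rf k (par_mid2 k x)" by auto
qed

lemma right_piece2:
  assumes "bb k \<le> x" "x \<le> 1"
  shows "D2 k x = x - k" "U2 k x = par_right2 k x"
proof -
  have "D2 k x = x - k \<and> U2 k x = par_right2 k x"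
  proof (cases "x = bb k")
    case True
    then have "par_mid2 k x = eta_b k" "par_right2 k x = eta_b k"
      using par_mid2(4) par_right2(4) by auto
    \<comment> \<open>The left side is the upper value of the middle piece at \<open>b\<close>,
      since \<open>R = k - E\<close> at \<open>eta_b k\<close>.\<close>
    moreover have "Ef k (eta_b k) - 2 + 2 * (k - Ef k (eta_b k)) = eta_b k"
      using eta_b(3) by (simp add: rho_def)
    ultimately show ?thesis
      using True mid_piece2[of x] k by (simp add: eta_b Rf_ends)
  next
    case False
    then show ?thesis using assms k by (simp add: D2_def U2_def)
  qed
  then show "D2 k x = x - k" "U2 k x = par_right2 k x" by auto
qed

lemma par_mid2_range: "aa k \<le> x \<Longrightarrow> x \<le> bb k \<Longrightarrow> par_mid2 k x \<in> {eta_b k..2}"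
  unfolding par_mid2(1)[symmetric] by auto

lemma continuous_D2: "continuous_on {-1..1} (D2 k)"
proof (rule continuous_on_glue, rule continuous_on_glue)
  show "continuous_on {-1..aa k} (D2 k)"
    by (rule continuous_on_eq[where f = "\<lambda>x. - x / 2 - 3 / 2"], intro continuous_intros)
      (auto simp: D2_def)
  show "continuous_on {aa k..bb k} (D2 k)"
    by (rule continuous_on_eq[where f = "\<lambda>x. rho k (par_mid2 k x) - k"],
        intro continuous_intros continuous_on_compose2[OF continuous_rho par_mid2(2) subset_UNIV])
      (simp add: mid_piece2)
  show "continuous_on {bb k..1} (D2 k)"
    by (rule continuous_on_eq[where f = "\<lambda>x. x - k"], intro continuous_intros)
      (simp add: right_piece2)
qed (use k in auto)

lemma continuous_U2: "continuous_on {-1..1} (U2 k)"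
proof (rule continuous_on_glue, rule continuous_on_glue)
  show "continuous_on {-1..aa k} (U2 k)"
    by (rule continuous_on_eq[where f = "\<lambda>x. 3 * x / 2 + 1 / 2"], intro continuous_intros)
      (auto simp: U2_def)
  show "continuous_on {aa k..bb k} (U2 k)"
    by (rule continuous_on_eq[where f = "\<lambda>x. Ef k (par_mid2 k x) - 2 + 2 * Rf k (par_mid2 k x)"],
        intro continuous_intros continuous_on_compose2[OF continuous_Ef par_mid2(2) subset_UNIV]
          continuous_on_compose2[OF continuous_Rf par_mid2(2) subset_UNIV])
      (simp add: mid_piece2)
  show "continuous_on {bb k..1} (U2 k)"
    by (rule continuous_on_eq[OF par_right2(2)]) (simp add: right_piece2)
qed (use k in auto)

text \<open>The parameter decreases as \<open>x\<close> grows, while \<open>\<rho>\<close> increases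
  and \<open>E\<close>, \<open>R\<close> do not increase in the parameter.\<close>

lemma mid_piece2_mono:
  assumes "aa k \<le> x" "x \<le> y" "y \<le> bb k"
  shows "D2 k y \<le> D2 k x" "U2 k x \<le> U2 k y"
proof -
  let ?s = "par_mid2 k y" and ?t = "par_mid2 k x"
  have st: "?s \<le> ?t" using par_mid2(3) assms by (auto simp: monotone_on_def)
  have r: "?s \<in> {eta_b k..2}" "?t \<in> {eta_b k..2}"
    using par_mid2_range assms by auto
  then show "D2 k y \<le> D2 k x"
    using strict_mono_on_leD[OF strict_mono_rho _ _ st] eta_b(1) assms by (simp add: mid_piece2)
  have "Ef k ?t \<le> Ef k ?s" using Ef_antimono[of ?s ?t] st by (cases "?s = ?t") auto
  then show "U2 k x \<le> U2 k y"
    using Rf_antimono[OF st] r assms by (simp add: mid_piece2)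
qed

lemma antimono_D2: "antimono_on {-1..bb k} (D2 k)"
proof (rule monotone_on_glue)
  show "antimono_on {-1..aa k} (D2 k)" by (rule monotone_onI) (auto simp: D2_def)
  show "antimono_on {aa k..bb k} (D2 k)" by (rule monotone_onI) (auto intro: mid_piece2_mono)
qed (use k in \<open>auto simp: transp_def\<close>)

lemma mono_U2: "mono_on {-1..1} (U2 k)"
proof (rule monotone_on_glue, rule monotone_on_glue)
  show "mono_on {-1..aa k} (U2 k)" by (rule monotone_onI) (auto simp: U2_def)
  show "mono_on {aa k..bb k} (U2 k)" by (rule monotone_onI) (auto intro: mid_piece2_mono)
  show "mono_on {bb k..1} (U2 k)"
    using par_right2(3) by (simp add: monotone_on_def right_piece2)
qed (use k in \<open>auto simp: transp_def\<close>)

lemma left_monotone_coupling_case2: "left_monotone k (measure_support (coupling k))"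
proof (rule left_monotone_coupling)
  have DU: "lowD k = D2 k" "upU k = U2 k"
    using k by (auto simp: lowD_def upU_def)
  show "continuous_on {-1..1} (lowD k)" "continuous_on {-1..1} (upU k)"
    "antimono_on {-1..bb k} (lowD k)" "mono_on {-1..1} (upU k)"
    unfolding DU by (fact continuous_D2 continuous_U2 antimono_D2 mono_U2)+
  \<comment> \<open>\<open>k \<ge> 2\<close> gives \<open>-1 \<le> a\<close>, so the affine formulas
    apply and both values are -1.\<close>
  show "lowD k (-1) \<le> upU k (-1)"
    using k by (simp add: DU D2_def U2_def)
  show "lowD k x = x - k \<and> x - k \<le> upU k x" if "bb k \<le> x" "x \<le> 1" for x
  proof -
    have "par_right2 k x \<in> {eta_b k..2}" unfolding par_right2(1)[symmetric] using that by auto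
    then show ?thesis using that eta_b(1) k by (simp add: DU right_piece2)
  qed
qed (use k in auto)

end

theorem proposition4p1:
  fixes k :: real
  assumes "1 < k" and "k < 3"
  shows "left_monotone k (measure_support (coupling k))"
  using left_monotone_coupling_case1 left_monotone_coupling_case2 assms by (cases "k < 2") auto

end
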